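(* Let $(M^{2m},\omega,\mathcal{L},\nabla)$ be a prequantum system. The cohomology $D^*(M,\mathcal{L})$ is concentrated in middle dimension $m$; that is, $D^k(M,\mathcal{L})=0$ for all $k\neq m$.
   Context: A prequantum system is a quadruple $(M,\omega,\mathcal{L},\nabla)$ where $(M^{2m},\omega)$ is a compact connected symplectic manifold of dimension $2m$ and $\mathcal{L}\to M$ is a hermitian complex line bundle with unitary connection $\nabla$ of curvature $\omega$, normalized so that the induced operator $\nabla:\Omega^*(M,\mathcal{L})\to\Omega^{*+1}(M,\mathcal{L})$ on $\mathcal{L}$-valued forms satisfies $\nabla^2=-i\,\omega\wedge$. Let $L=\omega\wedge$ on $\Omega^*(M,\mathcal{L})$ and $\Gamma^*(M,\mathcal{L})=\ker L\subset\Omega^*(M,\mathcal{L})$. The operator $\nabla$ preserves $\Gamma^*(M,\mathcal{L})$ and squares to zero there, and $D^*(M,\mathcal{L})=H^*(\Gamma^*(M,\mathcal{L}),\nabla)$ denotes the cohomology of the resulting complex. *)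

theory Defs
  imports "HOL-Analysis.Analysis" "HOL-Library.Function_Algebras"
begin

section \<open>Smooth manifolds\<close>

text \<open>
  The functions below are only ever used on open sets \<open>S\<close> of a finite-dimensional space, where
  existence and continuity of all iterated directional derivatives is the usual notion of \<open>C\<^sup>\<infinity>\<close>.
\<close>

primrec Ck_on :: "nat \<Rightarrow> 'e::real_normed_vector set \<Rightarrow> ('e \<Rightarrow> 'f::real_normed_vector) \<Rightarrow> bool" where
  "Ck_on 0 S f \<longleftrightarrow> continuous_on S f"
| "Ck_on (Suc n) S f \<longleftrightarrow>
     (\<forall>x\<in>S. f differentiable at x) \<and> (\<forall>v. Ck_on n S (\<lambda>x. frechet_derivative f (at x) v))"

definition smooth_on :: "'e::real_normed_vector set \<Rightarrow> ('e \<Rightarrow> 'f::real_normed_vector) \<Rightarrow> bool" where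
  "smooth_on S f \<longleftrightarrow> (\<forall>n. Ck_on n S f)"

text \<open>A chart \<open>(U, \<phi>)\<close>; the values of \<open>\<phi>\<close> outside \<open>U\<close> are irrelevant.\<close>

type_synonym ('a, 'e) chart = "'a set \<times> ('a \<Rightarrow> 'e)"

definition chart_inv :: "('a, 'e) chart \<Rightarrow> 'e \<Rightarrow> 'a" where
  "chart_inv c = inv_into (fst c) (snd c)"

definition transition_deriv ::
  "('a, 'e::real_normed_vector) chart \<Rightarrow> ('a, 'e) chart \<Rightarrow> 'a \<Rightarrow> 'e \<Rightarrow> 'e" where
  "transition_deriv c c' p = frechet_derivative (snd c' \<circ> chart_inv c) (at (snd c p))"

text \<open>
  The model space is an arbitrary real vector space of dimension \<open>n\<close> rather than a type of class
  \<open>euclidean_space\<close>, because the latter class excludes dimension \<open>0\<close>. The atlas is not required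
  to be maximal.
\<close>

definition smooth_manifold ::
  "nat \<Rightarrow> 'a topology \<Rightarrow> ('a, 'e::real_normed_vector) chart set \<Rightarrow> bool" where
  "smooth_manifold n M A \<longleftrightarrow>
     Hausdorff_space M \<and> second_countable M \<and>
     (\<exists>Bs::'e set. finite Bs \<and> independent Bs \<and> span Bs = UNIV \<and> card Bs = n) \<and>
     (\<forall>(U, \<phi>)\<in>A. openin M U \<and> open (\<phi> ` U) \<and>
        homeomorphic_map (subtopology M U) (top_of_set (\<phi> ` U)) \<phi>) \<and>
     (\<Union>c\<in>A. fst c) = topspace M \<and>
     (\<forall>c\<in>A. \<forall>c'\<in>A. smooth_on (snd c ` (fst c \<inter> fst c')) (snd c' \<circ> chart_inv c))"


section \<open>Hermitian line bundles\<close>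

text \<open>
  The total space is the disjoint union of complex lines \<open>fibre B p\<close>, which are subspaces of a
  complex vector space \<open>'v\<close> with scalar multiplication \<open>scal B\<close>. The space \<open>'v\<close> has no
  topology and merely provides fibrewise addition; any family of complex lines embeds in its
  direct sum. The smooth structure is given by nowhere vanishing local sections \<open>(V, s)\<close>,
  equivalently by the local trivializations \<open>z \<cdot> s p \<mapsto> (p, z)\<close>.
\<close>

record ('a, 'v) line_bundle =
  scal :: "complex \<Rightarrow> 'v \<Rightarrow> 'v"
  fibre :: "'a \<Rightarrow> 'v set"
  frames :: "('a set \<times> ('a \<Rightarrow> 'v)) set"

definition smooth_line_bundle ::
  "'a topology \<Rightarrow> ('a, 'e::real_normed_vector) chart set
    \<Rightarrow> ('a, 'v::ab_group_add) line_bundle \<Rightarrow> bool" where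
  "smooth_line_bundle M A B \<longleftrightarrow>
     vector_space (scal B) \<and>
     (\<forall>p\<in>topspace M. module.subspace (scal B) (fibre B p) \<and>
        vector_space.dim (scal B) (fibre B p) = 1) \<and>
     (\<forall>(V, s)\<in>frames B. openin M V \<and> (\<forall>p\<in>V. s p \<in> fibre B p \<and> s p \<noteq> 0)) \<and>
     (\<Union>(V, s)\<in>frames B. V) = topspace M \<and>
     (\<forall>c\<in>A. \<forall>(V, s)\<in>frames B. \<forall>(W, t)\<in>frames B.
        \<exists>g::'e \<Rightarrow> complex. smooth_on (snd c ` (fst c \<inter> V \<inter> W)) g \<and>
          (\<forall>p\<in>fst c \<inter> V \<inter> W. t p = scal B (g (snd c p)) (s p)))"

definition trivial_line_bundle :: "'a topology \<Rightarrow> ('a, complex) line_bundle" where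
  "trivial_line_bundle M =
     \<lparr>scal = (*), fibre = (\<lambda>_. UNIV), frames = {(topspace M, \<lambda>_. 1)}\<rparr>"

definition hermitian_metric ::
  "'a topology \<Rightarrow> ('a, 'e::real_normed_vector) chart set \<Rightarrow> ('a, 'v::ab_group_add) line_bundle
    \<Rightarrow> ('a \<Rightarrow> 'v \<Rightarrow> 'v \<Rightarrow> complex) \<Rightarrow> bool" where
  "hermitian_metric M A B h \<longleftrightarrow>
     (\<forall>p\<in>topspace M. \<forall>x\<in>fibre B p. \<forall>y\<in>fibre B p. \<forall>z\<in>fibre B p. \<forall>a.
        h p (x + y) z = h p x z + h p y z \<and>
        h p (scal B a x) z = a * h p x z \<and>
        h p y x = cnj (h p x y) \<and>
        (x \<noteq> 0 \<longrightarrow> h p x x \<in> \<real> \<and> 0 < Re (h p x x))) \<and>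
     (\<forall>c\<in>A. \<forall>(V, s)\<in>frames B. \<forall>(W, t)\<in>frames B.
        smooth_on (snd c ` (fst c \<inter> V \<inter> W))
          (\<lambda>x. h (chart_inv c x) (s (chart_inv c x)) (t (chart_inv c x))))"


section \<open>Differential forms\<close>

text \<open>
  A form is a family of local representatives: \<open>\<alpha> c p [v\<^sub>1, \<dots>, v\<^sub>k]\<close> is the value at \<open>p\<close> on the
  tangent vectors whose coordinates in the chart \<open>c\<close> are \<open>v\<^sub>1, \<dots>, v\<^sub>k\<close>. Representatives in
  different charts are related by the transition derivatives. Families vanish on all irrelevant
  arguments, so that equality of forms is equality of functions; addition and zero are pointwise.
  A section is a form of degree \<open>0\<close>, its value at \<open>p\<close> being \<open>\<alpha> c p []\<close>.
\<close>

type_synonym ('a, 'e, 'v) form = "('a, 'e) chart \<Rightarrow> 'a \<Rightarrow> 'e list \<Rightarrow> 'v"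

definition alternating ::
  "(complex \<Rightarrow> 'v \<Rightarrow> 'v) \<Rightarrow> nat \<Rightarrow> ('e::real_vector list \<Rightarrow> 'v::ab_group_add) \<Rightarrow> bool" where
  "alternating sc k a \<longleftrightarrow>
     (\<forall>vs. length vs \<noteq> k \<longrightarrow> a vs = 0) \<and>
     (\<forall>us v w ws. a (us @ (v + w) # ws) = a (us @ v # ws) + a (us @ w # ws)) \<and>
     (\<forall>us r v ws. a (us @ (r *\<^sub>R v) # ws) = sc (of_real r) (a (us @ v # ws))) \<and>
     (\<forall>vs. \<not> distinct vs \<longrightarrow> a vs = 0)"

definition bundle_forms ::
  "('a, 'e::real_normed_vector) chart set \<Rightarrow> ('a, 'v::ab_group_add) line_bundle
    \<Rightarrow> nat \<Rightarrow> ('a, 'e, 'v) form set" where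
  "bundle_forms A B k = {\<alpha>.
     (\<forall>c p vs. \<not> (c \<in> A \<and> p \<in> fst c) \<longrightarrow> \<alpha> c p vs = 0) \<and>
     (\<forall>c\<in>A. \<forall>p\<in>fst c. alternating (scal B) k (\<alpha> c p) \<and> range (\<alpha> c p) \<subseteq> fibre B p) \<and>
     (\<forall>c\<in>A. \<forall>c'\<in>A. \<forall>p\<in>fst c \<inter> fst c'. \<forall>vs.
        \<alpha> c' p (map (transition_deriv c c' p) vs) = \<alpha> c p vs) \<and>
     (\<forall>c\<in>A. \<forall>(V, s)\<in>frames B. \<forall>vs.
        \<exists>f::'e \<Rightarrow> complex. smooth_on (snd c ` (fst c \<inter> V)) f \<and>
          (\<forall>p\<in>fst c \<inter> V. \<alpha> c p vs = scal B (f (snd c p)) (s p)))}"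

abbreviation complex_forms ::
  "'a topology \<Rightarrow> ('a, 'e::real_normed_vector) chart set \<Rightarrow> nat \<Rightarrow> ('a, 'e, complex) form set" where
  "complex_forms M A k \<equiv> bundle_forms A (trivial_line_bundle M) k"

definition form_scale ::
  "('a, 'v) line_bundle \<Rightarrow> complex \<Rightarrow> ('a, 'e, 'v) form \<Rightarrow> ('a, 'e, 'v) form" where
  "form_scale B z \<alpha> = (\<lambda>c p vs. scal B z (\<alpha> c p vs))"

text \<open>
  Wedge product of a complex \<open>j\<close>-form with a \<open>B\<close>-valued form, as a sum over shuffles: \<open>S\<close> is the
  set of positions of the arguments passed to \<open>\<eta>\<close>, and the sign counts inversions. For forms of
  degree \<open>1\<close>, \<open>(\<eta> \<and> \<alpha>)(v, w) = \<eta>(v) \<alpha>(w) - \<eta>(w) \<alpha>(v)\<close>.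
\<close>

definition wedge ::
  "('a, 'v::ab_group_add) line_bundle \<Rightarrow> nat \<Rightarrow> ('a, 'e, complex) form
    \<Rightarrow> ('a, 'e, 'v) form \<Rightarrow> ('a, 'e, 'v) form" where
  "wedge B j \<eta> \<alpha> = (\<lambda>c p vs.
     \<Sum>S | S \<subseteq> {..<length vs} \<and> card S = j.
       scal B ((-1) ^ card {(a, b). a \<in> S \<and> b \<in> {..<length vs} - S \<and> b < a} * \<eta> c p (nths vs S))
         (\<alpha> c p (nths vs (- S))))"

definition ext_deriv ::
  "('a, 'e::real_normed_vector, complex) form \<Rightarrow> ('a, 'e, complex) form" where
  "ext_deriv \<eta> = (\<lambda>c p vs. if p \<in> fst c then
     (\<Sum>i<length vs. (-1) ^ i *
        frechet_derivative (\<lambda>x. \<eta> c (chart_inv c x) (take i vs @ drop (Suc i) vs))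
          (at (snd c p)) (vs ! i))
     else 0)"

definition symplectic_form ::
  "'a topology \<Rightarrow> ('a, 'e::real_normed_vector) chart set \<Rightarrow> ('a, 'e, complex) form \<Rightarrow> bool" where
  "symplectic_form M A \<omega> \<longleftrightarrow>
     \<omega> \<in> complex_forms M A 2 \<and> (\<forall>c p vs. \<omega> c p vs \<in> \<real>) \<and>
     ext_deriv \<omega> = 0 \<and>
     (\<forall>c\<in>A. \<forall>p\<in>fst c. \<forall>v. v \<noteq> 0 \<longrightarrow> (\<exists>w. \<omega> c p [v, w] \<noteq> 0))"


section \<open>Connections and prequantum systems\<close>

text \<open>A connection, as an operator from sections to bundle-valued \<open>1\<close>-forms.\<close>

definition connection ::
  "'a topology \<Rightarrow> ('a, 'e::real_normed_vector) chart set \<Rightarrow> ('a, 'v::ab_group_add) line_bundle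
    \<Rightarrow> (('a, 'e, 'v) form \<Rightarrow> ('a, 'e, 'v) form) \<Rightarrow> bool" where
  "connection M A B nabla \<longleftrightarrow>
     (\<forall>s\<in>bundle_forms A B 0. nabla s \<in> bundle_forms A B 1) \<and>
     (\<forall>s\<in>bundle_forms A B 0. \<forall>t\<in>bundle_forms A B 0. nabla (s + t) = nabla s + nabla t) \<and>
     (\<forall>f\<in>complex_forms M A 0. \<forall>s\<in>bundle_forms A B 0.
        nabla (wedge B 0 f s) = wedge B 1 (ext_deriv f) s + wedge B 0 f (nabla s))"

definition section_pairing ::
  "('a \<Rightarrow> 'v \<Rightarrow> 'v \<Rightarrow> complex) \<Rightarrow> ('a, 'e, 'v) form \<Rightarrow> ('a, 'e, 'v) form
    \<Rightarrow> ('a, 'e, complex) form" where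
  "section_pairing h s t = (\<lambda>c p vs. if vs = [] then h p (s c p []) (t c p []) else 0)"

definition unitary_connection ::
  "'a topology \<Rightarrow> ('a, 'e::real_normed_vector) chart set \<Rightarrow> ('a, 'v::ab_group_add) line_bundle
    \<Rightarrow> ('a \<Rightarrow> 'v \<Rightarrow> 'v \<Rightarrow> complex) \<Rightarrow> (('a, 'e, 'v) form \<Rightarrow> ('a, 'e, 'v) form) \<Rightarrow> bool" where
  "unitary_connection M A B h nabla \<longleftrightarrow>
     connection M A B nabla \<and>
     (\<forall>s\<in>bundle_forms A B 0. \<forall>t\<in>bundle_forms A B 0. \<forall>c\<in>A. \<forall>p\<in>fst c. \<forall>v.
        ext_deriv (section_pairing h s t) c p [v] =
          h p (nabla s c p [v]) (t c p []) + h p (s c p []) (nabla t c p [v]))"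

text \<open>
  The operator \<open>D\<close> on bundle-valued forms of all degrees induced by a connection: the unique
  extension of the connection satisfying the graded Leibniz rule (uniqueness holds because every
  bundle-valued form on a compact manifold is a finite sum of products \<open>\<eta> \<and> s\<close> with sections \<open>s\<close>).
\<close>

definition induced_operator ::
  "'a topology \<Rightarrow> ('a, 'e::real_normed_vector) chart set \<Rightarrow> ('a, 'v::ab_group_add) line_bundle
    \<Rightarrow> (('a, 'e, 'v) form \<Rightarrow> ('a, 'e, 'v) form)
    \<Rightarrow> (('a, 'e, 'v) form \<Rightarrow> ('a, 'e, 'v) form) \<Rightarrow> bool" where
  "induced_operator M A B nabla D \<longleftrightarrow>
     (\<forall>s\<in>bundle_forms A B 0. D s = nabla s) \<and>
     (\<forall>k. \<forall>\<alpha>\<in>bundle_forms A B k. D \<alpha> \<in> bundle_forms A B (Suc k)) \<and>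
     (\<forall>k. \<forall>\<alpha>\<in>bundle_forms A B k. \<forall>\<beta>\<in>bundle_forms A B k. D (\<alpha> + \<beta>) = D \<alpha> + D \<beta>) \<and>
     (\<forall>j k. \<forall>\<eta>\<in>complex_forms M A j. \<forall>\<alpha>\<in>bundle_forms A B k.
        D (wedge B j \<eta> \<alpha>) =
          wedge B (Suc j) (ext_deriv \<eta>) \<alpha> + form_scale B ((-1) ^ j) (wedge B j \<eta> (D \<alpha>)))"

definition prequantum_system ::
  "nat \<Rightarrow> 'a topology \<Rightarrow> ('a, 'e::real_normed_vector) chart set \<Rightarrow> ('a, 'e, complex) form
    \<Rightarrow> ('a, 'v::ab_group_add) line_bundle \<Rightarrow> ('a \<Rightarrow> 'v \<Rightarrow> 'v \<Rightarrow> complex)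
    \<Rightarrow> (('a, 'e, 'v) form \<Rightarrow> ('a, 'e, 'v) form)
    \<Rightarrow> (('a, 'e, 'v) form \<Rightarrow> ('a, 'e, 'v) form) \<Rightarrow> bool" where
  "prequantum_system m M A \<omega> B h nabla D \<longleftrightarrow>
     smooth_manifold (2 * m) M A \<and> compact_space M \<and> connected_space M \<and>
     symplectic_form M A \<omega> \<and>
     smooth_line_bundle M A B \<and> hermitian_metric M A B h \<and>
     unitary_connection M A B h nabla \<and>
     induced_operator M A B nabla D \<and>
     (\<forall>k. \<forall>\<alpha>\<in>bundle_forms A B k. D (D \<alpha>) = form_scale B (- \<i>) (wedge B 2 \<omega> \<alpha>))"


section \<open>Cohomology\<close>

text \<open>
  Cohomology in degree \<open>k\<close> of a complex \<open>C 0 \<rightarrow> C 1 \<rightarrow> \<dots>\<close> of subgroups of \<open>'x\<close> with differential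
  \<open>d\<close>, as the set of cosets of the coboundaries; \<open>C\<close> is zero in negative degrees.
\<close>

definition cocycles :: "(nat \<Rightarrow> 'x set) \<Rightarrow> ('x \<Rightarrow> 'x) \<Rightarrow> nat \<Rightarrow> 'x::ab_group_add set" where
  "cocycles C d k = {z \<in> C k. d z = 0}"

definition coboundaries :: "(nat \<Rightarrow> 'x set) \<Rightarrow> ('x \<Rightarrow> 'x) \<Rightarrow> nat \<Rightarrow> 'x::ab_group_add set" where
  "coboundaries C d k = (case k of 0 \<Rightarrow> {0} | Suc j \<Rightarrow> d ` C j)"

definition cohomology_class ::
  "(nat \<Rightarrow> 'x set) \<Rightarrow> ('x \<Rightarrow> 'x) \<Rightarrow> nat \<Rightarrow> 'x::ab_group_add \<Rightarrow> 'x set" where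
  "cohomology_class C d k z = (+) z ` coboundaries C d k"

definition cohomology :: "(nat \<Rightarrow> 'x set) \<Rightarrow> ('x \<Rightarrow> 'x) \<Rightarrow> nat \<Rightarrow> 'x::ab_group_add set set" where
  "cohomology C d k = cohomology_class C d k ` cocycles C d k"

text \<open>The forms annihilated by \<open>\<omega> \<and>\<close>.\<close>

definition Gamma_forms ::
  "('a, 'e::real_normed_vector) chart set \<Rightarrow> ('a, 'v::ab_group_add) line_bundle
    \<Rightarrow> ('a, 'e, complex) form \<Rightarrow> nat \<Rightarrow> ('a, 'e, 'v) form set" where
  "Gamma_forms A B \<omega> k = {\<alpha> \<in> bundle_forms A B k. wedge B 2 \<omega> \<alpha> = 0}"

lemma Ck_on_const: "Ck_on n S (\<lambda>x. c)"
  by (induction n arbitrary: c) auto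

lemma zero_in_bundle_forms:
  fixes A :: "('a, 'e::real_normed_vector) chart set"
  assumes "smooth_manifold n M A" "smooth_line_bundle M A B"
  shows "0 \<in> bundle_forms A B k"
proof -
  have vs: "vector_space (scal B)"
    and sub: "\<forall>p\<in>topspace M. module.subspace (scal B) (fibre B p)"
    using assms(2) unfolding smooth_line_bundle_def ball_conj_distrib
    by - (elim conjE, assumption)+
  interpret vector_space "scal B" by (rule vs)
  have cov: "(\<Union>c\<in>A. fst c) = topspace M"
    using assms(1) unfolding smooth_manifold_def by - (elim conjE, assumption)+
  have 1: "0 \<in> fibre B p" if "c \<in> A" "p \<in> fst c" for c p
  proof -
    have "p \<in> topspace M" unfolding cov[symmetric] using that by (rule UN_I)
    then have "module.subspace (scal B) (fibre B p)" by (rule bspec[OF sub])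
    then show ?thesis by (rule subspace_0)
  qed
  have 2: "smooth_on S (\<lambda>x::'e. 0::complex)" for S by (simp add: smooth_on_def Ck_on_const)
  show ?thesis
    unfolding bundle_forms_def alternating_def mem_Collect_eq
  proof (intro conjI ballI allI impI)
    fix c x vs assume "c \<in> A" "x \<in> frames B"
    then show "case x of (V, s) \<Rightarrow> \<forall>vs. \<exists>f::'e \<Rightarrow> complex. smooth_on (snd c ` (fst c \<inter> V)) f \<and>
          (\<forall>p\<in>fst c \<inter> V. 0 c p vs = scal B (f (snd c p)) (s p))"
      by (cases x) (simp, rule exI[where x = "\<lambda>_. 0"], simp add: 2)
  next
    fix c p assume "c \<in> A" "p \<in> fst c"
    then have "0 \<in> fibre B p" by (rule 1)
    then show "range (0 c p) \<subseteq> fibre B p" by (simp add: image_subset_iff)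
  qed simp_all
qed

text \<open>The induced operator preserves \<open>Gamma_forms\<close> and squares to zero there.\<close>

lemma Gamma_forms_subcomplex:
  assumes sys: "prequantum_system m M A \<omega> B h nabla D" and \<alpha>: "\<alpha> \<in> Gamma_forms A B \<omega> k"
  shows "D \<alpha> \<in> Gamma_forms A B \<omega> (Suc k)" and "D (D \<alpha>) = 0"
proof -
  have mfd: "smooth_manifold (2 * m) M A" and sf: "symplectic_form M A \<omega>"
    and lb: "smooth_line_bundle M A B" and ind: "induced_operator M A B nabla D"
    and sq: "\<forall>k. \<forall>\<alpha>\<in>bundle_forms A B k. D (D \<alpha>) = form_scale B (- \<i>) (wedge B 2 \<omega> \<alpha>)"
    using sys unfolding prequantum_system_def by - (elim conjE, assumption)+
  have \<omega>: "\<omega> \<in> complex_forms M A 2" "ext_deriv \<omega> = 0"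
    using sf unfolding symplectic_form_def by - (elim conjE, assumption)+
  have deg: "\<forall>k. \<forall>\<alpha>\<in>bundle_forms A B k. D \<alpha> \<in> bundle_forms A B (Suc k)"
    and add: "\<forall>k. \<forall>\<alpha>\<in>bundle_forms A B k. \<forall>\<beta>\<in>bundle_forms A B k. D (\<alpha> + \<beta>) = D \<alpha> + D \<beta>"
    and leibniz: "\<forall>j k. \<forall>\<eta>\<in>complex_forms M A j. \<forall>\<alpha>\<in>bundle_forms A B k.
        D (wedge B j \<eta> \<alpha>) =
          wedge B (Suc j) (ext_deriv \<eta>) \<alpha> + form_scale B ((-1) ^ j) (wedge B j \<eta> (D \<alpha>))"
    using ind unfolding induced_operator_def by - (elim conjE, assumption)+
  have vs: "vector_space (scal B)" using lb unfolding smooth_line_bundle_def by - (elim conjE, assumption)+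
  interpret vector_space "scal B" by (rule vs)
  have z: "0 \<in> bundle_forms A B 0" by (rule zero_in_bundle_forms[OF mfd lb])
  have a: "\<alpha> \<in> bundle_forms A B k" "wedge B 2 \<omega> \<alpha> = 0"
    using \<alpha> by (simp_all only: Gamma_forms_def mem_Collect_eq)
  have "D (0 + 0) = D 0 + D 0" using add z by blast
  then have D0: "D 0 = 0" by simp
  have "D (wedge B 2 \<omega> \<alpha>) =
      wedge B (Suc 2) (ext_deriv \<omega>) \<alpha> + form_scale B ((-1) ^ 2) (wedge B 2 \<omega> (D \<alpha>))"
    using leibniz \<omega>(1) a(1) by blast
  also have "wedge B (Suc 2) (ext_deriv \<omega>) \<alpha> = 0"
    unfolding \<omega>(2) wedge_def by (simp add: fun_eq_iff)
  also have "form_scale B ((-1) ^ 2) (wedge B 2 \<omega> (D \<alpha>)) = wedge B 2 \<omega> (D \<alpha>)"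
    unfolding form_scale_def by simp
  finally have "wedge B 2 \<omega> (D \<alpha>) = 0" unfolding a(2) D0 add_0_left by (rule sym)
  then show "D \<alpha> \<in> Gamma_forms A B \<omega> (Suc k)"
    unfolding Gamma_forms_def using deg a(1) by blast
  have "D (D \<alpha>) = form_scale B (- \<i>) (wedge B 2 \<omega> \<alpha>)" using sq a(1) by blast
  then show "D (D \<alpha>) = 0" unfolding a(2) form_scale_def by (simp add: fun_eq_iff)
qed

definition D_cohomology ::
  "('a, 'e::real_normed_vector) chart set \<Rightarrow> ('a, 'v::ab_group_add) line_bundle
    \<Rightarrow> ('a, 'e, complex) form \<Rightarrow> (('a, 'e, 'v) form \<Rightarrow> ('a, 'e, 'v) form)
    \<Rightarrow> nat \<Rightarrow> ('a, 'e, 'v) form set set" where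
  "D_cohomology A B \<omega> D k = cohomology (Gamma_forms A B \<omega>) D k"

end

theory Submission
  imports Defs "Jordan_Normal_Form.Determinant"
begin

text \<open>
  The only geometric input is the linear Lefschetz property: \<open>L = \<omega> \<and> _\<close> is injective on forms of
  degree \<open>k < m\<close> and maps onto the forms of degree \<open>k > m\<close>. For \<open>k < m\<close> it gives \<open>\<Gamma>\<^sup>k = 0\<close>. For
  \<open>k > m\<close> write a cocycle as \<open>z = L \<gamma>\<close> and put \<open>\<beta> = D (\<i> \<gamma>)\<close>; since \<open>D\<^sup>2 = - \<i> L\<close>, we get \<open>D \<beta> = z\<close> and
  \<open>- \<i> L \<beta> = D (D \<beta>) = D z = 0\<close>, so \<open>z\<close> is the coboundary of \<open>\<beta> \<in> \<Gamma>\<^sup>k\<^sup>-\<^sup>1\<close>.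

  The Lefschetz property follows from \<open>C L - L C = 2 (m - k)\<close> in degree \<open>k\<close>, where \<open>C\<close> is (twice) the
  contraction with the inverse bivector of \<open>\<omega>\<close>. Its coefficients are entries of the inverse matrix of
  \<open>\<omega>\<close>, which are smooth by Cramer's rule.
\<close>

section \<open>Smooth functions\<close>

lemma Ck_on_cong:
  assumes "open S" and "\<And>x. x \<in> S \<Longrightarrow> f x = g x" and "Ck_on n S f"
  shows "Ck_on n S g"
  using assms(2,3)
proof (induction n arbitrary: f g)
  case 0
  then show ?case by (simp cong: continuous_on_cong)
next
  case (Suc n)
  \<comment> \<open>Since \<open>S\<close> is open, agreement on \<open>S\<close> is agreement near
    \<open>x\<close>, so \<open>f\<close> and \<open>g\<close> share their derivative there.\<close>
  have "g differentiable at x" if "x \<in> S" for x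
  proof -
    have "(f has_derivative frechet_derivative f (at x)) (at x)"
      using Suc.prems that by (simp flip: frechet_derivative_works)
    then have "(g has_derivative frechet_derivative f (at x)) (at x)"
      by (rule has_derivative_transform_within_open[OF _ assms(1) that]) (simp add: Suc.prems)
    then show ?thesis by (rule differentiableI)
  qed
  moreover have "frechet_derivative f (at x) = frechet_derivative g (at x)" if "x \<in> S" for x
    using Suc.prems by (intro frechet_derivative_transform_within_open[OF _ assms(1) that]) (simp_all add: that)
  moreover have "Ck_on n S (\<lambda>x. frechet_derivative f (at x) v)" for v
    using Suc.prems(2) by simp
  ultimately show ?case using Suc.IH[of "\<lambda>x. frechet_derivative f (at x) v" for v] by simp
qed

text \<open>The recursion lowers the order by differentiating, so the inclusion of the classes needs
  an induction over derivatives that ends in "differentiable implies continuous".\<close>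

lemma Ck_on_Suc_imp: "Ck_on (Suc n) S f \<Longrightarrow> Ck_on n S f"
proof (induction n arbitrary: f)
  case 0
  then show ?case
    by (auto intro!: continuous_at_imp_continuous_on differentiable_imp_continuous_within)
next
  case (Suc n)
  have "Ck_on (Suc n) S (\<lambda>x. frechet_derivative f (at x) v)" for v
    using Suc.prems by simp
  then show ?case using Suc.IH Suc.prems by simp
qed

lemma Ck_on_add:
  assumes "open S" "Ck_on n S f" "Ck_on n S g"
  shows "Ck_on n S (\<lambda>x. f x + g x)"
  using assms(2,3)
proof (induction n arbitrary: f g)
  case 0
  then show ?case by (simp add: continuous_on_add)
next
  case (Suc n)
  have d: "((\<lambda>x. f x + g x) has_derivative
      (\<lambda>v. frechet_derivative f (at x) v + frechet_derivative g (at x) v)) (at x)" if "x \<in> S" for x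
    using Suc.prems that by (intro has_derivative_add) (simp_all flip: frechet_derivative_works)
  have "Ck_on n S (\<lambda>x. frechet_derivative (\<lambda>x. f x + g x) (at x) v)" for v
  proof (rule Ck_on_cong[OF assms(1)])
    show "Ck_on n S (\<lambda>x. frechet_derivative f (at x) v + frechet_derivative g (at x) v)"
      using Suc by simp
  qed (simp add: frechet_derivative_at[OF d, symmetric])
  then show ?case using differentiableI[OF d] by simp
qed

lemma Ck_on_mult:
  fixes f g :: "'e::real_normed_vector \<Rightarrow> 'f::real_normed_algebra"
  assumes "open S" "Ck_on n S f" "Ck_on n S g"
  shows "Ck_on n S (\<lambda>x. f x * g x)"
  using assms(2,3)
proof (induction n arbitrary: f g)
  case 0
  then show ?case by (simp add: continuous_on_mult)
next
  case (Suc n)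
  have d: "((\<lambda>x. f x * g x) has_derivative
      (\<lambda>v. f x * frechet_derivative g (at x) v + frechet_derivative f (at x) v * g x)) (at x)"
    if "x \<in> S" for x
    using Suc.prems that by (intro has_derivative_mult) (simp_all flip: frechet_derivative_works)
  have "Ck_on n S (\<lambda>x. frechet_derivative (\<lambda>x. f x * g x) (at x) v)" for v
  proof (rule Ck_on_cong[OF assms(1)])
    show "Ck_on n S (\<lambda>x. f x * frechet_derivative g (at x) v + frechet_derivative f (at x) v * g x)"
      \<comment> \<open>The product rule keeps one factor undifferentiated, so each factor is also
        needed at order \<open>n\<close>.\<close>
      using Suc.prems by (intro Ck_on_add[OF assms(1)] Suc.IH) (simp_all add: Ck_on_Suc_imp)
  qed (simp add: frechet_derivative_at[OF d, symmetric])
  then show ?case using differentiableI[OF d] by simp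
qed

text \<open>The derivative of 1/f is a product of derivatives of f and copies of 1/f, and the
  induction hypothesis covers those copies at order \<open>n\<close>.\<close>

lemma Ck_on_inverse:
  fixes f :: "'e::real_normed_vector \<Rightarrow> 'f::real_normed_div_algebra"
  assumes "open S" "\<And>x. x \<in> S \<Longrightarrow> f x \<noteq> 0" "Ck_on n S f"
  shows "Ck_on n S (\<lambda>x. inverse (f x))"
  using assms(3)
proof (induction n)
  case 0
  then show ?case using assms(2) by (simp add: continuous_on_inverse)
next
  case (Suc n)
  have d: "((\<lambda>x. inverse (f x)) has_derivative
      (\<lambda>v. - (inverse (f x) * frechet_derivative f (at x) v * inverse (f x)))) (at x)"
    if "x \<in> S" for x
    using Suc.prems that assms(2)
    by (intro Deriv.has_derivative_inverse) (simp_all flip: frechet_derivative_works)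
  have i: "Ck_on n S (\<lambda>x. inverse (f x))"
    using Suc Ck_on_Suc_imp by blast
  have "Ck_on n S (\<lambda>x. frechet_derivative (\<lambda>x. inverse (f x)) (at x) v)" for v
  proof (rule Ck_on_cong[OF assms(1)])
    show "Ck_on n S (\<lambda>x. (- 1) * (inverse (f x) * frechet_derivative f (at x) v * inverse (f x)))"
      using Suc.prems i by (intro Ck_on_mult[OF assms(1)] Ck_on_const) simp_all
    show "- 1 * (inverse (f x) * frechet_derivative f (at x) v * inverse (f x)) =
        frechet_derivative (\<lambda>x. inverse (f x)) (at x) v" if "x \<in> S" for x
      using fun_cong[OF frechet_derivative_at[OF d[OF that]], of v] by simp
  qed
  then show ?case using differentiableI[OF d] by simp
qed

lemma Ck_on_subset: "T \<subseteq> S \<Longrightarrow> Ck_on n S f \<Longrightarrow> Ck_on n T f"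
  by (induction n arbitrary: f) (auto intro: continuous_on_subset)

lemma smooth_on_subset: "smooth_on S f \<Longrightarrow> T \<subseteq> S \<Longrightarrow> smooth_on T f"
  unfolding smooth_on_def using Ck_on_subset by blast

lemma smooth_on_const [simp]: "smooth_on S (\<lambda>x. c)"
  unfolding smooth_on_def by (simp add: Ck_on_const)

lemma smooth_on_cong: "open S \<Longrightarrow> smooth_on S f \<Longrightarrow> (\<And>x. x \<in> S \<Longrightarrow> f x = g x) \<Longrightarrow> smooth_on S g"
  unfolding smooth_on_def using Ck_on_cong by blast

lemma smooth_on_add:
  "open S \<Longrightarrow> smooth_on S f \<Longrightarrow> smooth_on S g \<Longrightarrow> smooth_on S (\<lambda>x. f x + g x)"
  unfolding smooth_on_def by (simp add: Ck_on_add)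

lemma smooth_on_mult:
  fixes f g :: "'e::real_normed_vector \<Rightarrow> 'f::real_normed_algebra"
  shows "open S \<Longrightarrow> smooth_on S f \<Longrightarrow> smooth_on S g \<Longrightarrow> smooth_on S (\<lambda>x. f x * g x)"
  unfolding smooth_on_def by (simp add: Ck_on_mult)

lemma smooth_on_inverse:
  fixes f :: "'e::real_normed_vector \<Rightarrow> 'f::real_normed_div_algebra"
  shows "open S \<Longrightarrow> smooth_on S f \<Longrightarrow> (\<And>x. x \<in> S \<Longrightarrow> f x \<noteq> 0) \<Longrightarrow> smooth_on S (\<lambda>x. inverse (f x))"
  unfolding smooth_on_def by (simp add: Ck_on_inverse)

lemma smooth_on_sum:
  "open S \<Longrightarrow> (\<And>i. i \<in> I \<Longrightarrow> smooth_on S (f i)) \<Longrightarrow> smooth_on S (\<lambda>x. \<Sum>i\<in>I. f i x)"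
  by (induction I rule: infinite_finite_induct) (auto intro!: smooth_on_add)

lemma smooth_on_prod:
  fixes f :: "'i \<Rightarrow> 'e::real_normed_vector \<Rightarrow> 'f::real_normed_field"
  shows "open S \<Longrightarrow> (\<And>i. i \<in> I \<Longrightarrow> smooth_on S (f i)) \<Longrightarrow> smooth_on S (\<lambda>x. \<Prod>i\<in>I. f i x)"
  by (induction I rule: infinite_finite_induct) (auto intro!: smooth_on_mult)

section \<open>Cramer's rule with smooth coefficients\<close>

lemma smooth_on_det:
  fixes N :: "'e::real_normed_vector \<Rightarrow> complex mat"
  assumes "open S" and "\<And>x. N x \<in> carrier_mat n n"
    and "\<And>i j. i < n \<Longrightarrow> j < n \<Longrightarrow> smooth_on S (\<lambda>x. N x $$ (i, j))"
  shows "smooth_on S (\<lambda>x. Determinant.det (N x))"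
proof -
  have "Determinant.det (N x) =
      (\<Sum>p | p permutes {0..<n}. signof p * (\<Prod>i = 0..<n. N x $$ (i, p i)))" for x
    using assms(2) by (simp add: Determinant.det_def carrier_matD[OF assms(2)])
  then show ?thesis
    using assms
    by (auto intro!: smooth_on_sum smooth_on_mult smooth_on_prod assms(3) dest: permutes_in_image)
qed

lemma smooth_on_cofactor:
  fixes N :: "'e::real_normed_vector \<Rightarrow> complex mat"
  assumes "open S" and N: "\<And>x. N x \<in> carrier_mat n n"
    and "\<And>i j. i < n \<Longrightarrow> j < n \<Longrightarrow> smooth_on S (\<lambda>x. N x $$ (i, j))"
    and "i < n" "j < n"
  shows "smooth_on S (\<lambda>x. cofactor (N x) i j)"
  unfolding cofactor_def
proof (intro smooth_on_mult smooth_on_const assms(1))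
  show "smooth_on S (\<lambda>x. Determinant.det (mat_delete (N x) i j))"
  proof (rule smooth_on_det[OF assms(1)])
    show "mat_delete (N x) i j \<in> carrier_mat (n - 1) (n - 1)" for x
      using N by (rule mat_delete_carrier)
    show "smooth_on S (\<lambda>x. mat_delete (N x) i j $$ (i', j'))" if "i' < n - 1" "j' < n - 1" for i' j'
      using that assms(3-5) carrier_matD[OF N] by (auto simp: mat_delete_def)
  qed
qed

text \<open>Cramer's rule writes the inverse as cofactors divided by the determinant, all polynomial
  in the entries of \<open>N\<close>.\<close>

lemma smooth_on_matrix_solution:
  fixes N R :: "'e::real_normed_vector \<Rightarrow> complex mat"
  assumes S: "open S" and N: "\<And>x. N x \<in> carrier_mat n n" and R: "\<And>x. R x \<in> carrier_mat n n"
    and sm: "\<And>i j. i < n \<Longrightarrow> j < n \<Longrightarrow> smooth_on S (\<lambda>x. N x $$ (i, j))"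
    and inv: "\<And>x. x \<in> S \<Longrightarrow> N x * R x = 1\<^sub>m n"
    and ij: "i < n" "j < n"
  shows "smooth_on S (\<lambda>x. R x $$ (i, j))"
proof (rule smooth_on_cong[OF S])
  have nz: "Determinant.det (N x) \<noteq> 0" if "x \<in> S" for x
    using det_mult[OF N R, of x x] inv[OF that] by auto
  show "smooth_on S (\<lambda>x. cofactor (N x) j i * inverse (Determinant.det (N x)))"
    using nz by (intro smooth_on_mult smooth_on_inverse smooth_on_cofactor[OF S N sm]
        smooth_on_det[OF S N sm] S ij)
  fix x assume x: "x \<in> S"
  have "adj_mat (N x) = adj_mat (N x) * (N x * R x)"
    unfolding inv[OF x] by (rule right_mult_one_mat[OF adj_mat(1)[OF N], symmetric])
  also have "\<dots> = (Determinant.det (N x) \<cdot>\<^sub>m 1\<^sub>m n) * R x"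
    using assoc_mult_mat[OF adj_mat(1)[OF N] N R, of x x x] adj_mat(3)[OF N] by simp
  also have "\<dots> = Determinant.det (N x) \<cdot>\<^sub>m R x"
    using mult_smult_assoc_mat[of "1\<^sub>m n" n n "R x" n] R left_mult_one_mat[OF R] by simp
  finally have "adj_mat (N x) $$ (i, j) = Determinant.det (N x) * R x $$ (i, j)"
    using ij R[of x] by simp
  then have "cofactor (N x) j i = Determinant.det (N x) * R x $$ (i, j)"
    using ij N[of x] by (simp add: adj_mat_def)
  then show "cofactor (N x) j i * inverse (Determinant.det (N x)) = R x $$ (i, j)"
    using nz[OF x] by simp
qed


section \<open>Alternating maps and symplectic vector spaces\<close>

lemma alternating_length: "alternating sc k a \<Longrightarrow> length vs \<noteq> k \<Longrightarrow> a vs = 0"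
  unfolding alternating_def by blast

lemma alternating_add: "alternating sc k a \<Longrightarrow> a (us @ (v + w) # ws) = a (us @ v # ws) + a (us @ w # ws)"
  unfolding alternating_def by blast

lemma alternating_scaleR:
  "alternating sc k a \<Longrightarrow> a (us @ (r *\<^sub>R v) # ws) = sc (of_real r) (a (us @ v # ws))"
  unfolding alternating_def by blast

lemma alternating_not_distinct: "alternating sc k a \<Longrightarrow> \<not> distinct vs \<Longrightarrow> a vs = 0"
  unfolding alternating_def by blast

lemma alternating_zero_vector: "alternating sc k a \<Longrightarrow> a (us @ 0 # ws) = 0"
  using alternating_add[of sc k a us 0 0 ws] by simp

lemma alternating_sum_scaleR:
  assumes "alternating sc k a"
  shows "a (us @ (\<Sum>i\<in>I. r i *\<^sub>R x i) # ws) = (\<Sum>i\<in>I. sc (of_real (r i)) (a (us @ x i # ws)))"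
  by (induction I rule: infinite_finite_induct)
    (simp_all add: alternating_zero_vector[OF assms] alternating_add[OF assms] alternating_scaleR[OF assms])

text \<open>Polarization: expand the vanishing value with v + w in two adjacent slots.\<close>

lemma alternating_swap:
  assumes "alternating sc k a"
  shows "a (us @ v # w # ws) = - a (us @ w # v # ws)"
proof -
  have "0 = a (us @ (v + w) # (v + w) # ws)"
    using assms by (intro alternating_not_distinct[symmetric]) auto
  also have "\<dots> = a (us @ v # w # ws) + a (us @ w # v # ws)"
    using alternating_add[OF assms, of us v w "(v + w) # ws"]
      alternating_add[OF assms, of "us @ [v]" v w ws] alternating_add[OF assms, of "us @ [w]" v w ws]
      alternating_not_distinct[OF assms, of "us @ v # v # ws"]
      alternating_not_distinct[OF assms, of "us @ w # w # ws"] by simp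
  finally show ?thesis by (simp add: eq_neg_iff_add_eq_0)
qed

text \<open>An inductive criterion suited to recursion on the first argument: only the first slot
  and a repetition in the first two slots have to be checked.\<close>

lemma alternating_Suc_I:
  fixes a :: "'e::real_vector list \<Rightarrow> 'v::ab_group_add"
  assumes "a [] = 0"
    and alt: "\<And>v. alternating sc k (\<lambda>vs. a (v # vs))"
    and add: "\<And>v w vs. a ((v + w) # vs) = a (v # vs) + a (w # vs)"
    and scl: "\<And>r v vs. a ((r *\<^sub>R v) # vs) = sc (of_real r) (a (v # vs))"
    and rep: "\<And>v vs. a (v # v # vs) = 0"
  shows "alternating sc (Suc k) a"
  unfolding alternating_def
proof (intro conjI allI impI)
  fix vs :: "'e list" assume "length vs \<noteq> Suc k"
  then show "a vs = 0" using assms(1) alternating_length[OF alt] by (cases vs) auto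
next
  fix us ws :: "'e list" and v w :: 'e
  show "a (us @ (v + w) # ws) = a (us @ v # ws) + a (us @ w # ws)"
    using add alternating_add[OF alt] by (cases us) auto
next
  fix us ws :: "'e list" and v :: 'e and r :: real
  show "a (us @ r *\<^sub>R v # ws) = sc (of_real r) (a (us @ v # ws))"
    using scl alternating_scaleR[OF alt] by (cases us) auto
next
  \<comment> \<open>Polarization in the first two slots. A repetition of the head further down the
    list is thereby moved into the tail, where alternation is already known.\<close>
  have swap: "a (v # w # vs) = - a (w # v # vs)" for v w vs
    using rep[of "v + w" vs] rep[of v vs] rep[of w vs] add[of v w "(v + w) # vs"]
      alternating_add[OF alt, of v "[]" v w vs] alternating_add[OF alt, of w "[]" v w vs]
    by (simp add: eq_neg_iff_add_eq_0)
  fix vs :: "'e list" assume nd: "\<not> distinct vs"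
  then obtain v us where vs: "vs = v # us" by (cases vs) auto
  show "a vs = 0"
  proof (cases "distinct us")
    case False
    then show ?thesis using alternating_not_distinct[OF alt] vs by simp
  next
    case True
    then obtain w ws where us: "us = w # ws" and "v = w \<or> v \<in> set ws"
      using nd vs by (cases us) auto
    then show ?thesis
      using vs rep swap[of v w ws] alternating_not_distinct[OF alt, of "v # ws" w] by auto
  qed
qed

locale complex_vector_space = vector_space sc for sc :: "complex \<Rightarrow> 'v::ab_group_add \<Rightarrow> 'v"
begin

lemma alternating_add_fun:
  "alternating sc k a \<Longrightarrow> alternating sc k b \<Longrightarrow> alternating sc k (\<lambda>vs. a vs + b vs)"
  unfolding alternating_def by (auto simp: scale_right_distrib)

lemma alternating_scale_fun:
  "alternating sc k a \<Longrightarrow> alternating sc k (\<lambda>vs. sc z (a vs))"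
  unfolding alternating_def by (auto simp: scale_right_distrib scale_left_commute)

lemma alternating_zero_fun: "alternating sc k (\<lambda>vs. 0)"
  unfolding alternating_def by simp

lemma alternating_sum_fun:
  "(\<And>i. i \<in> I \<Longrightarrow> alternating sc k (a i)) \<Longrightarrow> alternating sc k (\<lambda>vs. \<Sum>i\<in>I. a i vs)"
  by (induction I rule: infinite_finite_induct) (auto intro: alternating_zero_fun alternating_add_fun)

text \<open>This is the interior product with \<open>v\<close>. In degree 0 it is zero, so the
  truncated degree \<open>k - 1\<close> does no harm.\<close>

lemma alternating_Cons:
  fixes a :: "'e::real_vector list \<Rightarrow> 'v"
  assumes "alternating sc k a"
  shows "alternating sc (k - 1) (\<lambda>vs. a (v # vs))"
proof (cases k)
  case 0
  then have "a (v # vs) = 0" for vs using alternating_length[OF assms] by simp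
  then show ?thesis by (simp add: alternating_zero_fun)
next
  case (Suc l)
  show ?thesis unfolding alternating_def
  proof (intro conjI allI impI)
    fix us ws :: "'e list" and x y :: 'e and r :: real
    show "a (v # us @ (x + y) # ws) = a (v # us @ x # ws) + a (v # us @ y # ws)"
      using alternating_add[OF assms, of "v # us"] by simp
    show "a (v # us @ r *\<^sub>R x # ws) = sc (of_real r) (a (v # us @ x # ws))"
      using alternating_scaleR[OF assms, of "v # us"] by simp
  qed (use assms Suc in \<open>auto intro: alternating_length alternating_not_distinct\<close>)
qed

lemma alternating_eq_0:
  fixes a :: "'e::real_vector list \<Rightarrow> 'v"
    and E :: "'e set"
  assumes a: "alternating sc k a" and E: "finite E" "real_vector.span E = UNIV" "card E < k"
  shows "a vs = 0"
proof -
  \<comment> \<open>\<open>us\<close> collects the arguments already expanded in \<open>E\<close>.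
    Once all are expanded, there are more of them than elements of \<open>E\<close>, so one is
    repeated.\<close>
  have gen: "a (us @ vs) = 0" if "set us \<subseteq> E" "card E < length (us @ vs)" for us vs
    using that
  proof (induction vs arbitrary: us)
    case Nil
    then have "\<not> distinct us"
      using card_mono[OF E(1), of "set us"] distinct_card[of us] by auto
    then show ?case using alternating_not_distinct[OF a] by simp
  next
    case (Cons v vs)
    have "v \<in> real_vector.span E" using E(2) by simp
    then obtain r where v: "v = (\<Sum>b\<in>E. r b *\<^sub>R b)"
      unfolding real_vector.span_finite[OF E(1)] by blast
    have "a (us @ b # vs) = 0" if "b \<in> E" for b
      using Cons.IH[of "us @ [b]"] Cons.prems that by simp
    then show ?case unfolding v alternating_sum_scaleR[OF a] by simp
  qed
  show ?thesis
    using gen[of "[]" vs] alternating_length[OF a, of vs] E(3) by force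
qed

end

section \<open>Shuffles and the wedge product at a point\<close>

definition inversions :: "nat \<Rightarrow> nat set \<Rightarrow> nat" where
  "inversions n S = card {(a, b). a \<in> S \<and> b \<in> {..<n} - S \<and> b < a}"

text \<open>The product \<open>wedge\<close> on one tangent space, separated from charts so that its
  algebra can be done fibrewise. The power of -1 is the sign of the shuffle bringing the positions
  in \<open>S\<close> to the front.\<close>

definition shuffle_wedge ::
  "(complex \<Rightarrow> 'v \<Rightarrow> 'v) \<Rightarrow> nat \<Rightarrow> ('e list \<Rightarrow> complex) \<Rightarrow> ('e list \<Rightarrow> 'v::ab_group_add) \<Rightarrow> 'e list \<Rightarrow> 'v"
where
  "shuffle_wedge sc j \<eta> a vs =
     (\<Sum>S | S \<subseteq> {..<length vs} \<and> card S = j.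
       sc ((-1) ^ inversions (length vs) S * \<eta> (nths vs S)) (a (nths vs (- S))))"

lemma wedge_eq_shuffle_wedge: "wedge B j \<eta> \<alpha> c p = shuffle_wedge (scal B) j (\<eta> c p) (\<alpha> c p)"
  unfolding wedge_def shuffle_wedge_def inversions_def by (rule refl)

text \<open>A selected position 0 has nothing before it, and the other positions merely shift by
  one.\<close>

lemma inversions_insert_0:
  "inversions (Suc n) (insert 0 (Suc ` T)) = inversions n T"
proof -
  have "{(a, b). a \<in> insert 0 (Suc ` T) \<and> b \<in> {..<Suc n} - insert 0 (Suc ` T) \<and> b < a}
    = map_prod Suc Suc ` {(a, b). a \<in> T \<and> b \<in> {..<n} - T \<and> b < a}" (is "?A = ?f ` ?B")
  proof (intro subset_antisym subsetI)
    fix z assume "z \<in> ?A"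
    then obtain a b where "z = (Suc a, Suc b)" "a \<in> T" "b \<in> {..<n} - T" "b < a"
      by (cases z; cases "snd z") auto
    then show "z \<in> ?f ` ?B" by force
  qed auto
  moreover have "inj_on ?f ?B" by (auto simp: inj_on_def)
  ultimately show ?thesis
    unfolding inversions_def by (simp only: card_image)
qed

text \<open>An unselected position 0 precedes every selected position, which costs one inversion for
  each of them.\<close>

lemma inversions_Suc_image:
  assumes "T \<subseteq> {..<n}"
  shows "inversions (Suc n) (Suc ` T) = inversions n T + card T"
proof -
  have fin: "finite T" using assms finite_subset by blast
  have "{(a, b). a \<in> Suc ` T \<and> b \<in> {..<Suc n} - Suc ` T \<and> b < a}
    = map_prod Suc Suc ` {(a, b). a \<in> T \<and> b \<in> {..<n} - T \<and> b < a} \<union> (\<lambda>a. (Suc a, 0)) ` T"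
    (is "?A = ?f ` ?B \<union> ?C")
  proof (intro subset_antisym subsetI)
    fix z assume "z \<in> ?A"
    then obtain a b where z: "z = (Suc a, b)" "a \<in> T" "b \<in> {..<Suc n} - Suc ` T" "b < Suc a"
      by (cases z) auto
    then show "z \<in> ?f ` ?B \<union> ?C" by (cases b) force+
  qed auto
  moreover have "finite ?B" by (rule finite_subset[of _ "T \<times> {..<n}"]) (auto simp: fin)
  moreover have "?f ` ?B \<inter> ?C = {}" by auto
  moreover have "inj_on ?f ?B" "inj_on (\<lambda>a. (Suc a, 0::nat)) T" by (auto simp: inj_on_def)
  ultimately show ?thesis
    unfolding inversions_def using fin by (simp only: card_Un_disjoint card_image finite_imageI)
qed

text \<open>Pascal's rule for sets: split according to whether position 0 is selected.\<close>

lemma subsets_card_Suc: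
  "{S. S \<subseteq> {..<Suc n} \<and> card S = Suc j} =
     (\<lambda>T. insert 0 (Suc ` T)) ` {T. T \<subseteq> {..<n} \<and> card T = j} \<union>
     (\<lambda>T. Suc ` T) ` {T. T \<subseteq> {..<n} \<and> card T = Suc j}" (is "?A = ?B \<union> ?C")
proof (intro subset_antisym subsetI)
  fix S assume S: "S \<in> ?A"
  define T where "T = {i. Suc i \<in> S}"
  have fin: "finite S" using S finite_subset by blast
  have ins: "S - {0} = Suc ` T"
    unfolding T_def using not0_implies_Suc by (auto simp: image_iff)
  have T: "T \<subseteq> {..<n}" using S by (auto simp: T_def)
  have "card T = card (S - {0})"
    unfolding ins by (simp add: card_image)
  then have card: "card T = (if 0 \<in> S then j else Suc j)"
    using S fin by (simp add: card_Diff_singleton_if)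
  show "S \<in> ?B \<union> ?C"
  proof (cases "0 \<in> S")
    case True
    then have "S = insert 0 (Suc ` T)" using ins by blast
    then show ?thesis using True T card by auto
  next
    case False
    then have "S = Suc ` T" using ins by blast
    then show ?thesis using False T card by auto
  qed
next
  fix S assume S: "S \<in> ?B \<union> ?C"
  have "finite T" if "T \<subseteq> {..<n}" for T using that finite_subset by blast
  then show "S \<in> ?A" using S by (auto simp: card_image card_insert_if)
qed

context complex_vector_space
begin

lemma shuffle_wedge_0: "shuffle_wedge sc 0 \<eta> a vs = sc (\<eta> []) (a vs)"
proof -
  have "{S. S \<subseteq> {..<length vs} \<and> card S = 0} = {{}}"
    using finite_subset[of _ "{..<length vs}"] by auto
  then show ?thesis
    by (simp add: shuffle_wedge_def inversions_def nths_all)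
qed

lemma shuffle_wedge_Suc_Nil: "shuffle_wedge sc (Suc j) \<eta> a [] = 0"
  unfolding shuffle_wedge_def by (rule sum.neutral) auto

text \<open>The interior product is an antiderivation of the wedge product. The two terms are the
  shuffles giving \<open>v\<close> to the left and to the right factor; passing over the left factor
  produces the sign. Later computations with wedge products rest on this recursion.\<close>

lemma shuffle_wedge_Suc_Cons:
  "shuffle_wedge sc (Suc j) \<eta> a (v # vs) =
     shuffle_wedge sc j (\<lambda>us. \<eta> (v # us)) a vs +
     sc ((-1) ^ Suc j) (shuffle_wedge sc (Suc j) \<eta> (\<lambda>us. a (v # us)) vs)"
proof -
  let ?n = "length vs"
  let ?P = "\<lambda>j. {T. T \<subseteq> {..<?n} \<and> card T = j}"
  let ?t = "\<lambda>S. sc ((-1) ^ inversions (Suc ?n) S * \<eta> (nths (v # vs) S)) (a (nths (v # vs) (- S)))"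
  have fin: "finite (?P j)" for j by (rule finite_subset[of _ "Pow {..<?n}"]) auto
  have inj: "inj_on (\<lambda>T. insert 0 (Suc ` T)) (?P j)" "inj_on (\<lambda>T. Suc ` T) (?P (Suc j))"
    by (auto simp: inj_on_def)
  have "shuffle_wedge sc (Suc j) \<eta> a (v # vs) =
      sum ?t ((\<lambda>T. insert 0 (Suc ` T)) ` ?P j) + sum ?t ((\<lambda>T. Suc ` T) ` ?P (Suc j))"
    unfolding shuffle_wedge_def length_Cons subsets_card_Suc
    by (rule sum.union_disjoint) (auto simp: fin)
  also have "sum ?t ((\<lambda>T. insert 0 (Suc ` T)) ` ?P j) = shuffle_wedge sc j (\<lambda>us. \<eta> (v # us)) a vs"
    unfolding shuffle_wedge_def sum.reindex[OF inj(1)] o_def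
    by (intro sum.cong refl) (simp add: inversions_insert_0 nths_Cons inj_image_mem_iff Collect_neg_eq)
  also have "sum ?t ((\<lambda>T. Suc ` T) ` ?P (Suc j)) =
      sc ((-1) ^ Suc j) (shuffle_wedge sc (Suc j) \<eta> (\<lambda>us. a (v # us)) vs)"
    unfolding shuffle_wedge_def sum.reindex[OF inj(2)] o_def scale_sum_right
    by (intro sum.cong refl)
      (auto simp: inversions_Suc_image nths_Cons inj_image_mem_iff Collect_neg_eq power_add mult_ac)
  finally show ?thesis .
qed


lemma shuffle_wedge_add_left:
  "shuffle_wedge sc j (\<lambda>us. \<eta> us + \<theta> us) a vs = shuffle_wedge sc j \<eta> a vs + shuffle_wedge sc j \<theta> a vs"
  by (simp add: shuffle_wedge_def distrib_left scale_left_distrib sum.distrib)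

lemma shuffle_wedge_scale_left:
  "shuffle_wedge sc j (\<lambda>us. z * \<eta> us) a vs = sc z (shuffle_wedge sc j \<eta> a vs)"
  by (simp add: shuffle_wedge_def scale_sum_right mult_ac)

lemma shuffle_wedge_zero_left: "shuffle_wedge sc j (\<lambda>us. 0) a vs = 0"
  by (simp add: shuffle_wedge_def)

lemma shuffle_wedge_add_right:
  "shuffle_wedge sc j \<eta> (\<lambda>us. a us + b us) vs = shuffle_wedge sc j \<eta> a vs + shuffle_wedge sc j \<eta> b vs"
  by (simp add: shuffle_wedge_def scale_right_distrib sum.distrib)

lemma shuffle_wedge_scale_right:
  "shuffle_wedge sc j \<eta> (\<lambda>us. sc z (a us)) vs = sc z (shuffle_wedge sc j \<eta> a vs)"
  by (simp add: shuffle_wedge_def scale_sum_right mult_ac)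

lemma shuffle_wedge_zero_right: "shuffle_wedge sc j \<eta> (\<lambda>us. 0) vs = 0"
  by (simp add: shuffle_wedge_def)

lemma shuffle_wedge_sum_right:
  "shuffle_wedge sc j \<eta> (\<lambda>us. \<Sum>i\<in>I. a i us) vs = (\<Sum>i\<in>I. shuffle_wedge sc j \<eta> (a i) vs)"
  by (induction I rule: infinite_finite_induct)
    (simp_all add: shuffle_wedge_zero_right shuffle_wedge_add_right)

end

interpretation complex_scalars: complex_vector_space "(*) :: complex \<Rightarrow> complex \<Rightarrow> complex"
  by unfold_locales (simp_all add: algebra_simps)

context complex_vector_space
begin

text \<open>The antiderivation rule with its first term gone, stated so as to include
  \<open>j = 0\<close>.\<close>

lemma shuffle_wedge_isotropic_Cons:
  assumes "\<And>us. \<eta> (v # us) = 0"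
  shows "shuffle_wedge sc j \<eta> a (v # vs) = sc ((-1) ^ j) (shuffle_wedge sc j \<eta> (\<lambda>us. a (v # us)) vs)"
proof (cases j)
  case 0
  then show ?thesis by (simp add: shuffle_wedge_0)
next
  case (Suc i)
  then show ?thesis by (simp add: shuffle_wedge_Suc_Cons assms shuffle_wedge_zero_left)
qed

text \<open>Induction on the total degree: by the antiderivation rule, inserting a first argument
  leaves wedge products of lower total degree, to which \<open>alternating_Suc_I\<close> can be
  applied.\<close>

lemma alternating_shuffle_wedge:
  fixes a :: "'e::real_vector list \<Rightarrow> 'v"
  assumes "alternating (*) j \<eta>" "alternating sc k a"
  shows "alternating sc (j + k) (shuffle_wedge sc j \<eta> a)"
  using assms
proof (induction "j + k" arbitrary: j k \<eta> a)
  case 0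
  then show ?case by (simp add: shuffle_wedge_0[abs_def] alternating_scale_fun)
next
  case (Suc n)
  show ?case
  proof (cases j)
    case 0
    then show ?thesis using Suc.prems by (simp add: shuffle_wedge_0[abs_def] alternating_scale_fun)
  next
    case j: (Suc i)
    note \<eta> = Suc.prems(1) and a = Suc.prems(2)
    have \<eta>': "alternating (*) i (\<lambda>us. \<eta> (v # us))" for v
      using complex_scalars.alternating_Cons[OF \<eta>, of v] j by simp
    have right: "alternating sc (i + k) (shuffle_wedge sc j \<eta> (\<lambda>us. a (v # us)))" for v
    proof (cases k)
      case 0
      then have "(\<lambda>us. a (v # us)) = (\<lambda>us. 0)" using alternating_length[OF a] by auto
      then show ?thesis by (simp add: shuffle_wedge_zero_right[abs_def] alternating_zero_fun)
    next
      case k: (Suc l)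
      have "alternating sc l (\<lambda>us. a (v # us))"
        using alternating_Cons[OF a, of v] k by simp
      then show ?thesis using Suc.hyps(1)[of j l \<eta>] Suc.hyps(2) \<eta> j k by simp
    qed
    have "alternating sc (Suc (i + k)) (shuffle_wedge sc (Suc i) \<eta> a)"
    proof (rule alternating_Suc_I)
      fix v w :: 'e and vs :: "'e list" and r :: real
      show "alternating sc (i + k) (\<lambda>vs. shuffle_wedge sc (Suc i) \<eta> a (v # vs))"
        unfolding shuffle_wedge_Suc_Cons
        using right[of v] Suc.hyps(1)[OF _ \<eta>' a] Suc.hyps(2) j
        by (intro alternating_add_fun alternating_scale_fun) simp_all
      have "\<eta> ((v + w) # us) = \<eta> (v # us) + \<eta> (w # us)" "a ((v + w) # us) = a (v # us) + a (w # us)" for us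
        using alternating_add[OF \<eta>, of "[]"] alternating_add[OF a, of "[]"] by simp_all
      then show "shuffle_wedge sc (Suc i) \<eta> a ((v + w) # vs) =
          shuffle_wedge sc (Suc i) \<eta> a (v # vs) + shuffle_wedge sc (Suc i) \<eta> a (w # vs)"
        by (simp add: shuffle_wedge_Suc_Cons shuffle_wedge_add_left shuffle_wedge_add_right
            scale_right_distrib)
      have "\<eta> ((r *\<^sub>R v) # us) = of_real r * \<eta> (v # us)" "a ((r *\<^sub>R v) # us) = sc (of_real r) (a (v # us))" for us
        using alternating_scaleR[OF \<eta>, of "[]"] alternating_scaleR[OF a, of "[]"] by simp_all
      then show "shuffle_wedge sc (Suc i) \<eta> a ((r *\<^sub>R v) # vs) =
          sc (of_real r) (shuffle_wedge sc (Suc i) \<eta> a (v # vs))"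
        by (simp add: shuffle_wedge_Suc_Cons shuffle_wedge_scale_left shuffle_wedge_scale_right
            scale_right_distrib scale_right_diff_distrib mult.commute)
      \<comment> \<open>Applying the antiderivation rule twice, the terms with both copies of
        \<open>v\<close> in one factor vanish, and the two mixed terms have opposite signs.\<close>
      have "\<eta> (v # v # us) = 0" "a (v # v # us) = 0" for us
        using alternating_not_distinct[OF \<eta>] alternating_not_distinct[OF a] by simp_all
      then show "shuffle_wedge sc (Suc i) \<eta> a (v # v # vs) = 0"
        by (simp add: shuffle_wedge_Suc_Cons[of _ _ _ v "v # vs"] shuffle_wedge_Suc_Cons[of _ _ _ v vs]
            shuffle_wedge_isotropic_Cons shuffle_wedge_zero_right)
    qed (rule shuffle_wedge_Suc_Nil)
    then show ?thesis using j by simp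
  qed
qed

text \<open>The degree operator: inserting a basis vector and wedging with its dual covector, summed
  over a basis, multiplies a \<open>k\<close>-form by \<open>k\<close>. Each argument slot
  contributes one copy of the form.\<close>

lemma sum_wedge_interior:
  fixes a :: "'e::real_vector list \<Rightarrow> 'v"
  assumes "alternating sc k a"
    and dual: "\<And>v. (\<Sum>i\<in>I. r i v *\<^sub>R g i) = v" "\<And>i v. i \<in> I \<Longrightarrow> \<eta> i [v] = of_real (r i v)"
  shows "(\<Sum>i\<in>I. shuffle_wedge sc (Suc 0) (\<eta> i) (\<lambda>us. a (g i # us)) vs) = sc (of_nat k) (a vs)"
proof -
  \<comment> \<open>Counting by the length of the argument list avoids the truncated degree
    \<open>k - 1\<close> in the induction. When the length is not \<open>k\<close>, the value of
    \<open>a\<close> is zero anyway.\<close>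
  have "(\<Sum>i\<in>I. shuffle_wedge sc (Suc 0) (\<eta> i) (\<lambda>us. a (g i # us)) vs) = sc (of_nat (length vs)) (a vs)"
    using assms(1)
  proof (induction vs arbitrary: a k)
    case Nil
    then show ?case by (simp add: shuffle_wedge_Suc_Nil)
  next
    case (Cons v vs)
    have "shuffle_wedge sc (Suc 0) (\<eta> i) (\<lambda>us. a (g i # us)) (v # vs) = sc (of_real (r i v)) (a (g i # vs)) +
        shuffle_wedge sc (Suc 0) (\<eta> i) (\<lambda>us. a (v # g i # us)) vs" if "i \<in> I" for i
    proof -
      have "(\<lambda>us. a (g i # v # us)) = (\<lambda>us. sc (- 1) (a (v # g i # us)))"
        using alternating_swap[OF Cons.prems, of "[]" "g i" v] by simp
      then show ?thesis
        using dual(2)[OF that] by (simp only: shuffle_wedge_Suc_Cons shuffle_wedge_0 shuffle_wedge_scale_right) simp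
    qed
    then have "(\<Sum>i\<in>I. shuffle_wedge sc (Suc 0) (\<eta> i) (\<lambda>us. a (g i # us)) (v # vs)) =
        (\<Sum>i\<in>I. sc (of_real (r i v)) (a (g i # vs))) + sc (of_nat (length vs)) (a (v # vs))"
      using Cons.IH[OF alternating_Cons[OF Cons.prems, of v]] by (simp add: sum.distrib)
    also have "(\<Sum>i\<in>I. sc (of_real (r i v)) (a (g i # vs))) = a (v # vs)"
      using alternating_sum_scaleR[OF Cons.prems, of "[]" "\<lambda>i. r i v" g I vs] dual(1)[of v] by simp
    finally show ?case by (simp add: scale_left_distrib)
  qed
  then show ?thesis using alternating_length[OF assms(1), of vs] by (cases "length vs = k") auto
qed

end

section \<open>Symplectic linear algebra: dual bases and contraction\<close>

definition contract :: "'e set \<Rightarrow> ('e \<Rightarrow> 'e) \<Rightarrow> ('e list \<Rightarrow> 'v::comm_monoid_add) \<Rightarrow> 'e list \<Rightarrow> 'v" where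
  "contract E f a vs = (\<Sum>b\<in>E. a (b # f b # vs))"

text \<open>The symplectic dual basis, with the dual vector in the second slot of \<open>w\<close>;
  this convention fixes the later signs. Used as the \<open>f\<close> of \<open>contract\<close>, it
  gives twice the contraction with the bivector inverse to \<open>w\<close>.\<close>

definition dual_vector :: "'e set \<Rightarrow> ('e list \<Rightarrow> complex) \<Rightarrow> 'e \<Rightarrow> 'e" where
  "dual_vector E w b = (SOME u. \<forall>b'\<in>E. w [b', u] = (if b' = b then 1 else 0))"

text \<open>Finite dimension enters through an explicit basis, since the model space is an arbitrary
  real vector space and may have dimension 0.\<close>

lemma linear_inj_imp_surj_finite_basis:
  fixes T :: "'e::real_vector \<Rightarrow> 'e" and E :: "'e set"
  assumes "finite E" "independent E" "span E = UNIV" "linear T" "inj T"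
  shows "surj T"
proof -
  interpret finite_dimensional_vector_space_pair scaleR E scaleR E
    by unfold_locales
      (use assms in \<open>auto simp: algebra_simps dependent_raw_def[symmetric] span_raw_def[symmetric]\<close>)
  show ?thesis using linear_injective_imp_surjective[of T] assms by (simp add: linear_def)
qed

text \<open>Forms are complex-valued throughout; realness of \<open>w\<close> allows its values to
  serve, through \<open>Re\<close>, as scalars on the real tangent space.\<close>

locale symplectic_space =
  fixes w :: "'e::real_vector list \<Rightarrow> complex" and E :: "'e set"
  assumes alt: "alternating (*) 2 w" and real: "w vs \<in> \<real>"
    and nondegenerate: "v \<noteq> 0 \<Longrightarrow> \<exists>u. w [v, u] \<noteq> 0"
    and basis: "finite E" "independent E" "span E = UNIV"
begin

lemma Re_add: "Re (w [u + v, x]) = Re (w [u, x]) + Re (w [v, x])" "Re (w [x, u + v]) = Re (w [x, u]) + Re (w [x, v])"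
  using alternating_add[OF alt, of "[]" u v "[x]"] alternating_add[OF alt, of "[x]" u v "[]"] by simp_all

lemma Re_scaleR: "Re (w [r *\<^sub>R u, x]) = r * Re (w [u, x])" "Re (w [x, r *\<^sub>R u]) = r * Re (w [x, u])"
  using alternating_scaleR[OF alt, of "[]" r u "[x]"] alternating_scaleR[OF alt, of "[x]" r u "[]"] by simp_all

lemma Re_sum: "Re (w [(\<Sum>i\<in>I. r i *\<^sub>R u i), x]) = (\<Sum>i\<in>I. r i * Re (w [u i, x]))"
  using alternating_sum_scaleR[OF alt, of "[]" r u I "[x]"] by simp

lemma skew: "w [u, v] = - w [v, u]"
  using alternating_swap[OF alt, of "[]" u v "[]"] by simp

lemma of_real_Re: "of_real (Re (w vs)) = w vs"
  using real[of vs] by (metis Reals_cases Re_complex_of_real)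

lemma expand: obtains r where "v = (\<Sum>b\<in>E. r b *\<^sub>R b)"
proof -
  have "v \<in> span E" using basis(3) by simp
  then show ?thesis using that unfolding span_finite[OF basis(1)] by blast
qed

lemma dual_exists:
  assumes "b \<in> E"
  shows "\<exists>u. \<forall>b'\<in>E. w [b', u] = (if b' = b then 1 else 0)"
proof -
  \<comment> \<open>The vector of pairings of \<open>v\<close> with the basis, encoded as an
    endomorphism of the same space. Nondegeneracy makes it injective, hence onto, and a preimage of
    \<open>b\<close> is the dual vector.\<close>
  define T where "T v = (\<Sum>b\<in>E. Re (w [b, v]) *\<^sub>R b)" for v
  have coeff: "r b = s b" if "(\<Sum>b\<in>E. r b *\<^sub>R b) = (\<Sum>b\<in>E. s b *\<^sub>R b)" "b \<in> E" for r s b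
    using independentD[OF basis(2,1) order.refl, of "\<lambda>b. r b - s b" b] that
    by (simp add: scaleR_diff_left sum_subtractf)
  have lin: "linear T"
    by (rule linearI) (simp_all add: T_def Re_add Re_scaleR scaleR_add_left sum.distrib scaleR_sum_right)
  have "inj T"
  proof (subst linear_injective_0[OF lin], intro allI impI)
    fix v assume "T v = 0"
    then have 0: "Re (w [b, v]) = 0" if "b \<in> E" for b
      using coeff[of "\<lambda>b. Re (w [b, v])" "\<lambda>b. 0" b] that by (simp add: T_def)
    have "w [v, u] = 0" for u
    proof -
      obtain r where "u = (\<Sum>b\<in>E. r b *\<^sub>R b)" by (rule expand)
      then have "Re (w [u, v]) = 0" by (simp add: Re_sum 0)
      then show ?thesis using skew[of v u] of_real_Re[of "[u, v]"] by simp
    qed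
    then show "v = 0" using nondegenerate by blast
  qed
  then have "surj T" by (rule linear_inj_imp_surj_finite_basis[OF basis lin])
  then obtain u where u: "T u = b" by (metis surjD)
  have "(\<Sum>b'\<in>E. (if b' = b then 1 else 0) *\<^sub>R b') = b"
    using assms basis(1) by (simp add: if_distrib[of "\<lambda>r. r *\<^sub>R _"] cong: if_cong)
  then have "Re (w [b', u]) = (if b' = b then 1 else 0)" if "b' \<in> E" for b'
    using coeff[of "\<lambda>b'. Re (w [b', u])" "\<lambda>b'. if b' = b then 1 else 0" b'] u that by (simp add: T_def)
  then show ?thesis using of_real_Re by (metis of_real_0 of_real_1)
qed

abbreviation "dual \<equiv> dual_vector E w"

lemma dual: "b \<in> E \<Longrightarrow> b' \<in> E \<Longrightarrow> w [b', dual b] = (if b' = b then 1 else 0)"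
  unfolding dual_vector_def using someI_ex[OF dual_exists] by blast

text \<open>Pairing with the dual vectors on the right reads off coordinates in
  \<open>E\<close>.\<close>

lemma sum_dual_left: "(\<Sum>b\<in>E. Re (w [v, dual b]) *\<^sub>R b) = v"
proof -
  obtain r where v: "v = (\<Sum>b\<in>E. r b *\<^sub>R b)" by (rule expand)
  have "Re (w [v, dual b]) = r b" if "b \<in> E" for b
    unfolding v Re_sum using that basis(1) dual[OF that]
    by (simp add: if_distrib[of Re] if_distrib[of "\<lambda>x. _ * x"] cong: sum.cong if_cong)
  then show ?thesis using v by simp
qed

text \<open>By skewness and \<open>sum_dual_left\<close> both sides pair equally with every vector,
  and \<open>w\<close> is nondegenerate.\<close>

lemma sum_dual_right: "(\<Sum>b\<in>E. Re (w [b, v]) *\<^sub>R dual b) = v"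
proof -
  let ?u = "\<Sum>b\<in>E. Re (w [b, v]) *\<^sub>R dual b"
  have "Re (w [?u, x]) = Re (w [v, x])" for x
  proof -
    have "Re (w [v, x]) = - Re (w [(\<Sum>b\<in>E. Re (w [x, dual b]) *\<^sub>R b), v])"
      using skew[of v x] by (simp add: sum_dual_left)
    also have "\<dots> = Re (w [?u, x])"
      unfolding Re_sum using skew[of x] by (simp add: sum_negf mult.commute)
    finally show ?thesis by simp
  qed
  then have "w [?u + (- 1) *\<^sub>R v, x] = 0" for x
    using Re_add(1)[of ?u "(- 1) *\<^sub>R v" x] Re_scaleR(1)[of "- 1" v x] of_real_Re[of "[?u + (- 1) *\<^sub>R v, x]"] by simp
  then have "?u + (- 1) *\<^sub>R v = 0" using nondegenerate by blast
  then show ?thesis by simp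
qed

end

locale symplectic_space_values = complex_vector_space sc + symplectic_space w E
  for sc :: "complex \<Rightarrow> 'v::ab_group_add \<Rightarrow> 'v" and w :: "'e::real_vector list \<Rightarrow> complex" and E
begin

text \<open>
  Contraction is contraction with the bivector inverse to \<open>w\<close>, so it may be computed with any
  dual pair of families; this makes it compatible with changes of charts.
\<close>

lemma contract_eq:
  assumes a: "alternating sc k a" and xy: "\<And>v. (\<Sum>i\<in>I. Re (w [v, y i]) *\<^sub>R x i) = v"
  shows "(\<Sum>i\<in>I. a (x i # y i # vs)) = contract E dual a vs"
proof -
  \<comment> \<open>Expanding \<open>y i\<close> in the dual vectors on one side, and each
    \<open>b\<close> in the \<open>x i\<close> on the other, yields the same double sum.\<close>
  have "a (x i # y i # vs) = (\<Sum>b\<in>E. sc (w [b, y i]) (a (x i # dual b # vs)))" for i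
    using alternating_sum_scaleR[OF a, of "[x i]" "\<lambda>b. Re (w [b, y i])" dual E vs]
    by (simp add: sum_dual_right of_real_Re)
  moreover have "a (b # dual b # vs) = (\<Sum>i\<in>I. sc (w [b, y i]) (a (x i # dual b # vs)))" for b
    using alternating_sum_scaleR[OF a, of "[]" "\<lambda>i. Re (w [b, y i])" x I "dual b # vs"]
    by (simp add: xy of_real_Re)
  ultimately show ?thesis unfolding contract_def by (simp add: sum.swap[of _ E])
qed

text \<open>The sl(2) commutator relation. Inserting \<open>b\<close> and then \<open>dual b\<close>
  into the wedge product gives four terms: the pairing of \<open>b\<close> with
  \<open>dual b\<close> sums to the dimension, each mixed term sums to the degree by
  \<open>sum_wedge_interior\<close>, and the last is the wedge with the contraction.\<close>

lemma contract_shuffle_wedge: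
  assumes a: "alternating sc k a"
  shows "contract E dual (shuffle_wedge sc 2 w a) vs =
    shuffle_wedge sc 2 w (contract E dual a) vs + sc (of_nat (card E) - 2 * of_nat k) (a vs)"
proof -
  let ?W = "shuffle_wedge sc"
  \<comment> \<open>The factor -1 is pulled into the second mixed term because, by skewness, -
    w(dual b, v) is the coordinate of v along b.\<close>
  have "?W 2 w a (b # dual b # vs) = a vs
      - ?W (Suc 0) (\<lambda>us. w (b # us)) (\<lambda>us. a (dual b # us)) vs
      - ?W (Suc 0) (\<lambda>us. - 1 * w (dual b # us)) (\<lambda>us. a (b # us)) vs
      + ?W 2 w (\<lambda>us. a (b # dual b # us)) vs" if "b \<in> E" for b
    using dual[OF that that]
    by (simp only: shuffle_wedge_scale_left)
      (simp add: numeral_2_eq_2 shuffle_wedge_Suc_Cons shuffle_wedge_0)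
  then have "contract E dual (?W 2 w a) vs = sc (of_nat (card E)) (a vs)
      - (\<Sum>b\<in>E. ?W (Suc 0) (\<lambda>us. w (b # us)) (\<lambda>us. a (dual b # us)) vs)
      - (\<Sum>b\<in>E. ?W (Suc 0) (\<lambda>us. - 1 * w (dual b # us)) (\<lambda>us. a (b # us)) vs)
      + ?W 2 w (contract E dual a) vs"
    unfolding contract_def[abs_def] shuffle_wedge_sum_right
    by (simp add: sum.distrib sum_subtractf sum_constant_scale)
  also have "(\<Sum>b\<in>E. ?W (Suc 0) (\<lambda>us. w (b # us)) (\<lambda>us. a (dual b # us)) vs) = sc (of_nat k) (a vs)"
    by (rule sum_wedge_interior[OF a, where r = "\<lambda>b v. Re (w [b, v])"]) (simp_all add: sum_dual_right of_real_Re)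
  also have "(\<Sum>b\<in>E. ?W (Suc 0) (\<lambda>us. - 1 * w (dual b # us)) (\<lambda>us. a (b # us)) vs) = sc (of_nat k) (a vs)"
    using skew[of "dual _"] sum_dual_left
    by (intro sum_wedge_interior[OF a, where r = "\<lambda>b v. Re (w [v, dual b])" and g = "\<lambda>b. b"]) (simp_all add: of_real_Re)
  also have "sc (of_nat (card E)) (a vs) - sc (of_nat k) (a vs) - sc (of_nat k) (a vs) =
      sc (of_nat (card E) - 2 * of_nat k) (a vs)"
    unfolding mult_2 diff_diff_eq[symmetric] scale_left_diff_distrib by (rule refl)
  finally show ?thesis by (simp only: add.commute)
qed

end


section \<open>The Lefschetz property of symplectic manifolds\<close>

text \<open>The smoothness clause of \<open>bundle_forms\<close> for a single coefficient, isolated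
  so that its closure properties are proved once.\<close>

definition smooth_multiple ::
  "('a, 'v) line_bundle \<Rightarrow> ('a, 'e::real_normed_vector) chart \<Rightarrow> 'a set \<Rightarrow> ('a \<Rightarrow> 'v) \<Rightarrow> ('a \<Rightarrow> 'v) \<Rightarrow> bool"
where
  "smooth_multiple B c V s \<sigma> \<longleftrightarrow>
     (\<exists>f. smooth_on (snd c ` (fst c \<inter> V)) f \<and> (\<forall>p\<in>fst c \<inter> V. \<sigma> p = scal B (f (snd c p)) (s p)))"

text \<open>One basis \<open>E\<close> of the model space serves in all charts; agreement between
  charts of what is computed with it is proved separately.\<close>

locale symplectic_line_bundle =
  fixes m :: nat and M :: "'a topology" and A :: "('a, 'e::real_normed_vector) chart set"
    and \<omega> :: "('a, 'e, complex) form" and B :: "('a, 'v::ab_group_add) line_bundle" and E :: "'e set"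
  assumes manifold: "smooth_manifold (2 * m) M A" and symplectic: "symplectic_form M A \<omega>"
    and line_bundle: "smooth_line_bundle M A B"
    and basis: "finite E" "independent E" "span E = UNIV" and card_basis: "card E = 2 * m"
begin

sublocale complex_vector_space "scal B"
proof -
  have "vector_space (scal B)"
    using line_bundle unfolding smooth_line_bundle_def by - (elim conjE, assumption)+
  then show "complex_vector_space (scal B)" by (simp add: complex_vector_space_def)
qed

sublocale forms: vector_space "form_scale B :: complex \<Rightarrow> ('a, 'e, 'v) form \<Rightarrow> _"
  by unfold_locales
    (simp_all add: form_scale_def fun_eq_iff scale_right_distrib scale_left_distrib)

section \<open>Charts, frames and bundle-valued forms\<close>

lemma chart:
  assumes "c \<in> A"
  shows "openin M (fst c)" "open (snd c ` fst c)"
    "homeomorphic_map (subtopology M (fst c)) (top_of_set (snd c ` fst c)) (snd c)"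
  using assms manifold unfolding smooth_manifold_def by (auto simp: case_prod_beta)

lemma inj_on_chart: "c \<in> A \<Longrightarrow> inj_on (snd c) (fst c)"
  using homeomorphic_imp_injective_map[OF chart(3), of c] openin_subset[OF chart(1), of c]
  by (simp add: Int_absorb1)

lemma open_chart_image:
  assumes "c \<in> A" "openin M V"
  shows "open (snd c ` (fst c \<inter> V))"
proof -
  have "openin (subtopology M (fst c)) (fst c \<inter> V)"
    using assms(2) by (simp add: openin_subtopology_Int2)
  then have "openin (top_of_set (snd c ` fst c)) (snd c ` (fst c \<inter> V))"
    using homeomorphic_imp_open_map[OF chart(3)[OF assms(1)]] unfolding open_map_def by blast
  then show ?thesis using chart(2)[OF assms(1)] openin_open_eq by blast
qed

lemma frame_open:
  assumes "(V, s) \<in> frames B"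
  shows "openin M V"
proof -
  have "\<forall>(V, s)\<in>frames B. openin M V \<and> (\<forall>p\<in>V. s p \<in> fibre B p \<and> s p \<noteq> 0)"
    using line_bundle unfolding smooth_line_bundle_def by - (elim conjE, assumption)+
  then show ?thesis using assms by auto
qed

lemma fibre_subspace:
  assumes "c \<in> A" "p \<in> fst c"
  shows "subspace (fibre B p)"
proof -
  have "p \<in> topspace M" using openin_subset[OF chart(1)[OF assms(1)]] assms(2) by blast
  moreover have "\<forall>p\<in>topspace M. subspace (fibre B p) \<and> dim (fibre B p) = 1"
    using line_bundle unfolding smooth_line_bundle_def by - (elim conjE, assumption)+
  ultimately show ?thesis by blast
qed

lemma smooth_multiple_add:
  assumes "c \<in> A" "(V, s) \<in> frames B" "smooth_multiple B c V s \<sigma>" "smooth_multiple B c V s \<tau>"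
  shows "smooth_multiple B c V s (\<lambda>p. \<sigma> p + \<tau> p)"
proof -
  obtain f g where "smooth_on (snd c ` (fst c \<inter> V)) f" "\<forall>p\<in>fst c \<inter> V. \<sigma> p = scal B (f (snd c p)) (s p)"
    "smooth_on (snd c ` (fst c \<inter> V)) g" "\<forall>p\<in>fst c \<inter> V. \<tau> p = scal B (g (snd c p)) (s p)"
    using assms(3,4) unfolding smooth_multiple_def by blast
  then show ?thesis
    unfolding smooth_multiple_def using open_chart_image[OF assms(1) frame_open[OF assms(2)]]
    by (intro exI[of _ "\<lambda>x. f x + g x"]) (simp add: smooth_on_add scale_left_distrib)
qed

lemma smooth_multiple_scale:
  assumes "c \<in> A" "(V, s) \<in> frames B" "smooth_multiple B c V s \<sigma>"
    and "smooth_on (snd c ` fst c) g" "\<And>p. p \<in> fst c \<Longrightarrow> z p = g (snd c p)"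
  shows "smooth_multiple B c V s (\<lambda>p. scal B (z p) (\<sigma> p))"
proof -
  obtain f where "smooth_on (snd c ` (fst c \<inter> V)) f" "\<forall>p\<in>fst c \<inter> V. \<sigma> p = scal B (f (snd c p)) (s p)"
    using assms(3) unfolding smooth_multiple_def by blast
  moreover have "smooth_on (snd c ` (fst c \<inter> V)) g"
    by (rule smooth_on_subset[OF assms(4)]) blast
  ultimately show ?thesis
    unfolding smooth_multiple_def using open_chart_image[OF assms(1) frame_open[OF assms(2)]]
    by (intro exI[of _ "\<lambda>x. g x * f x"]) (simp add: smooth_on_mult assms(5))
qed

lemma smooth_multiple_zero: "smooth_multiple B c V s (\<lambda>p. 0)"
  unfolding smooth_multiple_def by (intro exI[of _ "\<lambda>x. 0"]) simp

lemma smooth_multiple_sum: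
  assumes "c \<in> A" "(V, s) \<in> frames B" "\<And>i. i \<in> I \<Longrightarrow> smooth_multiple B c V s (\<sigma> i)"
  shows "smooth_multiple B c V s (\<lambda>p. \<Sum>i\<in>I. \<sigma> i p)"
  using assms(3)
  by (induction I rule: infinite_finite_induct)
    (simp_all add: smooth_multiple_zero smooth_multiple_add[OF assms(1,2)])

lemma smooth_multiple_cong:
  "smooth_multiple B c V s \<sigma> \<Longrightarrow> (\<And>p. p \<in> fst c \<Longrightarrow> \<tau> p = \<sigma> p) \<Longrightarrow> smooth_multiple B c V s \<tau>"
  unfolding smooth_multiple_def by (metis IntD1)

lemma bundle_formsI:
  assumes "\<And>c p vs. \<not> (c \<in> A \<and> p \<in> fst c) \<Longrightarrow> \<alpha> c p vs = 0"
    and "\<And>c p. c \<in> A \<Longrightarrow> p \<in> fst c \<Longrightarrow> alternating (scal B) k (\<alpha> c p)"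
    and "\<And>c p vs. c \<in> A \<Longrightarrow> p \<in> fst c \<Longrightarrow> \<alpha> c p vs \<in> fibre B p"
    and "\<And>c c' p vs. c \<in> A \<Longrightarrow> c' \<in> A \<Longrightarrow> p \<in> fst c \<Longrightarrow> p \<in> fst c' \<Longrightarrow>
      \<alpha> c' p (map (transition_deriv c c' p) vs) = \<alpha> c p vs"
    and "\<And>c V s vs. c \<in> A \<Longrightarrow> (V, s) \<in> frames B \<Longrightarrow> smooth_multiple B c V s (\<lambda>p. \<alpha> c p vs)"
  shows "\<alpha> \<in> bundle_forms A B k"
  unfolding bundle_forms_def smooth_multiple_def[symmetric] mem_Collect_eq
  using assms by blast

context
  fixes \<alpha> :: "('a, 'e, 'v) form" and k :: nat
  assumes \<alpha>: "\<alpha> \<in> bundle_forms A B k"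
begin

lemma form_outside: "\<not> (c \<in> A \<and> p \<in> fst c) \<Longrightarrow> \<alpha> c p vs = 0"
  using \<alpha>[unfolded bundle_forms_def mem_Collect_eq, THEN conjunct1] by blast

lemma form_alternating: "c \<in> A \<Longrightarrow> p \<in> fst c \<Longrightarrow> alternating (scal B) k (\<alpha> c p)"
  using \<alpha>[unfolded bundle_forms_def mem_Collect_eq, THEN conjunct2, THEN conjunct1] by blast

lemma form_fibre: "c \<in> A \<Longrightarrow> p \<in> fst c \<Longrightarrow> \<alpha> c p vs \<in> fibre B p"
  using \<alpha>[unfolded bundle_forms_def mem_Collect_eq, THEN conjunct2, THEN conjunct1] by blast

lemma form_transition:
  "c \<in> A \<Longrightarrow> c' \<in> A \<Longrightarrow> p \<in> fst c \<Longrightarrow> p \<in> fst c' \<Longrightarrow> \<alpha> c' p (map (transition_deriv c c' p) vs) = \<alpha> c p vs"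
  using \<alpha>[unfolded bundle_forms_def mem_Collect_eq, THEN conjunct2, THEN conjunct2, THEN conjunct1] by blast

lemma form_smooth: "c \<in> A \<Longrightarrow> (V, s) \<in> frames B \<Longrightarrow> smooth_multiple B c V s (\<lambda>p. \<alpha> c p vs)"
  using \<alpha>[unfolded bundle_forms_def mem_Collect_eq, THEN conjunct2, THEN conjunct2, THEN conjunct2]
  unfolding smooth_multiple_def by blast

end

lemma zero_form: "0 \<in> bundle_forms A B k"
  by (rule zero_in_bundle_forms[OF manifold line_bundle])

lemma add_form:
  assumes "\<alpha> \<in> bundle_forms A B k" "\<beta> \<in> bundle_forms A B k"
  shows "\<alpha> + \<beta> \<in> bundle_forms A B k"
proof (rule bundle_formsI)
  fix c p assume c: "c \<in> A" "p \<in> fst c"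
  show "alternating (scal B) k ((\<alpha> + \<beta>) c p)"
    using alternating_add_fun[OF assms[THEN form_alternating, OF c]] by (simp add: plus_fun_def)
  show "(\<alpha> + \<beta>) c p vs \<in> fibre B p" for vs
    using subspace_add[OF fibre_subspace[OF c] assms[THEN form_fibre, OF c]] by simp
next
  fix c V s vs assume c: "c \<in> A" "(V, s) \<in> frames B"
  show "smooth_multiple B c V s (\<lambda>p. (\<alpha> + \<beta>) c p vs)"
    using smooth_multiple_add[OF c assms[THEN form_smooth, OF c]] by simp
qed (simp_all add: assms[THEN form_outside] assms[THEN form_transition])

lemma scale_form:
  assumes "\<alpha> \<in> bundle_forms A B k"
  shows "form_scale B z \<alpha> \<in> bundle_forms A B k"
proof (rule bundle_formsI)
  fix c p assume c: "c \<in> A" "p \<in> fst c"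
  show "alternating (scal B) k (form_scale B z \<alpha> c p)"
    using alternating_scale_fun[OF form_alternating[OF assms c]] by (simp add: form_scale_def)
  show "form_scale B z \<alpha> c p vs \<in> fibre B p" for vs
    using subspace_scale[OF fibre_subspace[OF c] form_fibre[OF assms c]] by (simp add: form_scale_def)
next
  fix c V s vs assume "c \<in> A" "(V, s) \<in> frames B"
  then show "smooth_multiple B c V s (\<lambda>p. form_scale B z \<alpha> c p vs)"
    unfolding form_scale_def using form_smooth[OF assms]
    by (intro smooth_multiple_scale[where g = "\<lambda>x. z"]) simp_all
qed (simp_all add: form_scale_def form_outside[OF assms] form_transition[OF assms])

lemma complex_form_alternating:
  assumes "\<eta> \<in> complex_forms M A j" "c \<in> A" "p \<in> fst c"
  shows "alternating (*) j (\<eta> c p)"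
  using assms(1)[unfolded bundle_forms_def mem_Collect_eq, THEN conjunct2, THEN conjunct1] assms(2,3)
  by (simp add: trivial_line_bundle_def)

lemma complex_form_transition:
  assumes "\<eta> \<in> complex_forms M A j" "c \<in> A" "c' \<in> A" "p \<in> fst c" "p \<in> fst c'"
  shows "\<eta> c' p (map (transition_deriv c c' p) vs) = \<eta> c p vs"
  using assms(1)[unfolded bundle_forms_def mem_Collect_eq, THEN conjunct2, THEN conjunct2, THEN conjunct1] assms(2-) by blast

lemma complex_form_smooth:
  assumes "\<eta> \<in> complex_forms M A j" "c \<in> A"
  obtains f where "smooth_on (snd c ` fst c) f" "\<And>p. p \<in> fst c \<Longrightarrow> \<eta> c p vs = f (snd c p)"
proof -
  have "fst c \<inter> topspace M = fst c"
    using openin_subset[OF chart(1)[OF assms(2)]] by blast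
  moreover have "\<exists>f. smooth_on (snd c ` (fst c \<inter> topspace M)) f \<and> (\<forall>p\<in>fst c \<inter> topspace M. \<eta> c p vs = f (snd c p) * 1)"
    using assms(1)[unfolded bundle_forms_def mem_Collect_eq, THEN conjunct2, THEN conjunct2, THEN conjunct2] assms(2)
    by (simp add: trivial_line_bundle_def)
  ultimately show ?thesis using that by auto
qed

lemma wedge_form:
  assumes \<eta>: "\<eta> \<in> complex_forms M A j" and \<alpha>: "\<alpha> \<in> bundle_forms A B k"
  shows "wedge B j \<eta> \<alpha> \<in> bundle_forms A B (j + k)"
proof (rule bundle_formsI)
  fix c p assume c: "c \<in> A" "p \<in> fst c"
  show "alternating (scal B) (j + k) (wedge B j \<eta> \<alpha> c p)"
    unfolding wedge_eq_shuffle_wedge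
    by (rule alternating_shuffle_wedge[OF complex_form_alternating[OF \<eta> c] form_alternating[OF \<alpha> c]])
  show "wedge B j \<eta> \<alpha> c p vs \<in> fibre B p" for vs
    unfolding wedge_def
    by (intro subspace_sum[OF fibre_subspace[OF c]] subspace_scale[OF fibre_subspace[OF c]] form_fibre[OF \<alpha> c])
next
  fix c c' p vs assume "c \<in> A" "c' \<in> A" "p \<in> fst c" "p \<in> fst c'"
  then show "wedge B j \<eta> \<alpha> c' p (map (transition_deriv c c' p) vs) = wedge B j \<eta> \<alpha> c p vs"
    unfolding wedge_def nths_map length_map
    by (simp add: form_transition[OF \<alpha>] complex_form_transition[OF \<eta>])
next
  fix c V s vs assume c: "c \<in> A" and V: "(V, s) \<in> frames B"
  show "smooth_multiple B c V s (\<lambda>p. wedge B j \<eta> \<alpha> c p vs)"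
    unfolding wedge_def
  proof (intro smooth_multiple_sum[OF c V])
    fix S
    obtain f where f: "smooth_on (snd c ` fst c) f" "\<And>p. p \<in> fst c \<Longrightarrow> \<eta> c p (nths vs S) = f (snd c p)"
      using complex_form_smooth[OF \<eta> c] by blast
    show "smooth_multiple B c V s (\<lambda>p. scal B ((-1) ^ card {(a, b). a \<in> S \<and> b \<in> {..<length vs} - S \<and> b < a} *
        \<eta> c p (nths vs S)) (\<alpha> c p (nths vs (- S))))" (is "smooth_multiple B c V s (\<lambda>p. scal B (?e * _) _)")
      by (rule smooth_multiple_scale[OF c V form_smooth[OF \<alpha> c V], where g = "\<lambda>x. ?e * f x"])
        (simp_all add: f smooth_on_mult chart(2)[OF c])
  qed
qed (simp add: wedge_def form_outside[OF \<alpha>])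

section \<open>The symplectic form in charts\<close>

lemma \<omega>_form: "\<omega> \<in> complex_forms M A 2"
  using symplectic unfolding symplectic_form_def by blast

lemma symplectic_tangent_space:
  assumes "c \<in> A" "p \<in> fst c"
  shows "symplectic_space (\<omega> c p) E"
proof
  show "alternating (*) 2 (\<omega> c p)" by (rule complex_form_alternating[OF \<omega>_form assms])
  have real: "\<forall>c p vs. \<omega> c p vs \<in> \<real>"
    using symplectic unfolding symplectic_form_def by - (elim conjE, assumption)
  show "\<omega> c p vs \<in> \<real>" for vs by (rule real[rule_format])
  show "\<exists>u. \<omega> c p [v, u] \<noteq> 0" if "v \<noteq> 0" for v
    using symplectic assms that unfolding symplectic_form_def by blast
qed (fact basis)+

lemma symplectic_fibre: "c \<in> A \<Longrightarrow> p \<in> fst c \<Longrightarrow> symplectic_space_values (scal B) (\<omega> c p) E"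
  using symplectic_tangent_space complex_vector_space_axioms
  by (simp add: symplectic_space_values_def)

lemma transition_deriv_linear:
  assumes "c \<in> A" "c' \<in> A" "p \<in> fst c" "p \<in> fst c'"
  shows "linear (transition_deriv c c' p)"
proof -
  have "smooth_on (snd c ` (fst c \<inter> fst c')) (snd c' \<circ> chart_inv c)"
    using manifold assms(1,2) unfolding smooth_manifold_def by - (elim conjE, blast)
  then have "Ck_on (Suc 0) (snd c ` (fst c \<inter> fst c')) (snd c' \<circ> chart_inv c)"
    unfolding smooth_on_def by blast
  then have "(snd c' \<circ> chart_inv c) differentiable at (snd c p)"
    using assms(3,4) by simp
  then show ?thesis unfolding transition_deriv_def by (rule linear_frechet_derivative)
qed

text \<open>Invertibility is read off from \<omega>: it is preserved by the chart change, so a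
  vector killed by the derivative pairs to zero with everything.\<close>

lemma transition_deriv_surj:
  assumes "c \<in> A" "c' \<in> A" "p \<in> fst c" "p \<in> fst c'"
  shows "surj (transition_deriv c c' p)"
proof (rule linear_inj_imp_surj_finite_basis[OF basis transition_deriv_linear[OF assms]])
  interpret s: symplectic_space "\<omega> c p" E by (rule symplectic_tangent_space[OF assms(1,3)])
  show "inj (transition_deriv c c' p)"
  proof (subst linear_injective_0[OF transition_deriv_linear[OF assms]], intro allI impI)
    fix v assume "transition_deriv c c' p v = 0"
    then have "\<omega> c p [v, u] = \<omega> c' p [0, transition_deriv c c' p u]" for u
      using complex_form_transition[OF \<omega>_form assms, of "[v, u]"] by simp
    also have "\<omega> c' p [0, x] = 0" for x
      using alternating_zero_vector[OF complex_form_alternating[OF \<omega>_form assms(2,4)], of "[]"] by simp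
    finally show "v = 0" using s.nondegenerate by blast
  qed
qed

text \<open>The coordinates of the dual vectors form the inverse of the Gram matrix of \<omega>,
  whose entries are smooth; Cramer's rule does the rest.\<close>

lemma dual_coordinate_smooth:
  assumes c: "c \<in> A" and "b \<in> E" "l \<in> E"
  obtains g where "smooth_on (snd c ` fst c) g"
    "\<And>p. p \<in> fst c \<Longrightarrow> complex_of_real (real_vector.representation E (dual_vector E (\<omega> c p) b) l) = g (snd c p)"
proof -
  let ?n = "card E" and ?S = "snd c ` fst c"
  let ?r = "\<lambda>p b l. complex_of_real (real_vector.representation E (dual_vector E (\<omega> c p) b) l)"
  obtain e where e: "bij_betw e {0..<?n} E" using ex_bij_betw_nat_finite[OF basis(1)] by blast
  have eE: "e i \<in> E" if "i < ?n" for i using bij_betwE[OF e] that by simp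
  have "\<forall>vs. \<exists>f. smooth_on ?S f \<and> (\<forall>p\<in>fst c. \<omega> c p vs = f (snd c p))"
    by (metis complex_form_smooth[OF \<omega>_form c])
  then obtain F where F: "smooth_on ?S (F vs)" "p \<in> fst c \<Longrightarrow> \<omega> c p vs = F vs (snd c p)" for vs p
    by metis
  \<comment> \<open>\<open>N\<close> is the Gram matrix of \<omega> in the enumerated basis, and
    column \<open>b\<close> of \<open>G\<close> holds the coordinates of the dual vector of
    \<open>e b\<close>. Their product has entries \<omega>(e i, dual (e j)).\<close>
  define N where "N x = mat ?n ?n (\<lambda>(i, j). F [e i, e j] x)" for x
  define G where "G x = mat ?n ?n (\<lambda>(l, b). ?r (chart_inv c x) (e b) (e l))" for x
  have inv: "chart_inv c (snd c p) = p" if "p \<in> fst c" for p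
    using inj_on_chart[OF c] that by (simp add: chart_inv_def)
  have NG: "N x * G x = 1\<^sub>m ?n" if "x \<in> ?S" for x
  proof (rule eq_matI)
    obtain p where p: "p \<in> fst c" "x = snd c p" using \<open>x \<in> ?S\<close> by blast
    interpret s: symplectic_space "\<omega> c p" E by (rule symplectic_tangent_space[OF c p(1)])
    fix i j assume "i < dim_row (1\<^sub>m ?n :: complex mat)" "j < dim_col (1\<^sub>m ?n :: complex mat)"
    then have ij: "i < ?n" "j < ?n" by simp_all
    have "(N x * G x) $$ (i, j) = (\<Sum>l = 0..<?n. \<omega> c p [e i, e l] * ?r p (e j) (e l))"
      using ij by (simp add: N_def G_def scalar_prod_def p inv F(2))
    also have "\<dots> = (\<Sum>l\<in>E. \<omega> c p [e i, l] * ?r p (e j) l)"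
      by (rule sum.reindex_bij_betw[OF e])
    also have "\<dots> = \<omega> c p [e i, (\<Sum>l\<in>E. real_vector.representation E (s.dual (e j)) l *\<^sub>R l)]"
      using alternating_sum_scaleR[OF s.alt, of "[e i]" "real_vector.representation E (s.dual (e j))" "\<lambda>l. l" E "[]"]
      by (simp add: mult.commute)
    also have "(\<Sum>l\<in>E. real_vector.representation E (s.dual (e j)) l *\<^sub>R l) = s.dual (e j)"
      using real_vector.sum_representation_eq[OF basis(2) _ basis(1) order.refl] basis(3) by simp
    also have "\<omega> c p [e i, s.dual (e j)] = 1\<^sub>m ?n $$ (i, j)"
      using ij s.dual[OF eE[OF ij(2)] eE[OF ij(1)]] bij_betw_imp_inj_on[OF e] by (simp add: inj_on_eq_iff)
    finally show "(N x * G x) $$ (i, j) = 1\<^sub>m ?n $$ (i, j)" .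
  qed (simp_all add: N_def G_def)
  have "l \<in> e ` {0..<?n}" "b \<in> e ` {0..<?n}"
    using assms(2,3) by (simp_all only: bij_betw_imp_surj_on[OF e])
  then obtain i j where ij: "i < ?n" "j < ?n" "l = e i" "b = e j" by auto
  have "smooth_on ?S (\<lambda>x. G x $$ (i, j))"
  proof (rule smooth_on_matrix_solution[OF chart(2)[OF c] _ _ _ NG ij(1,2)])
    show "N x \<in> carrier_mat ?n ?n" "G x \<in> carrier_mat ?n ?n" for x by (simp_all add: N_def G_def)
    show "smooth_on ?S (\<lambda>x. N x $$ (i, j))" if "i < ?n" "j < ?n" for i j
      using that F(1) by (simp add: N_def)
  qed
  then show ?thesis using that[of "\<lambda>x. G x $$ (i, j)"] ij by (simp add: G_def inv)
qed

section \<open>Contraction with the inverse bivector as an operator on forms\<close>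

definition contraction :: "('a, 'e, 'v) form \<Rightarrow> ('a, 'e, 'v) form" where
  "contraction \<alpha> = (\<lambda>c p vs. if c \<in> A \<and> p \<in> fst c then contract E (dual_vector E (\<omega> c p)) (\<alpha> c p) vs else 0)"

lemma contraction_form:
  assumes \<alpha>: "\<alpha> \<in> bundle_forms A B k"
  shows "contraction \<alpha> \<in> bundle_forms A B (k - 2)"
proof (rule bundle_formsI)
  fix c p assume c: "c \<in> A" "p \<in> fst c"
  have "alternating (scal B) (k - 2) (\<lambda>vs. \<alpha> c p (v # w # vs))" for v w
    using alternating_Cons[OF alternating_Cons[OF form_alternating[OF \<alpha> c], of v], of w]
    by (simp add: numeral_2_eq_2)
  then show "alternating (scal B) (k - 2) (contraction \<alpha> c p)"
    unfolding contraction_def contract_def using c by (simp add: alternating_sum_fun)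
  show "contraction \<alpha> c p vs \<in> fibre B p" for vs
    unfolding contraction_def contract_def using c
    by (simp add: subspace_sum[OF fibre_subspace[OF c]] form_fibre[OF \<alpha> c])
next
  fix c c' p vs assume c: "c \<in> A" "c' \<in> A" "p \<in> fst c" "p \<in> fst c'"
  let ?T = "transition_deriv c c' p"
  interpret s: symplectic_space "\<omega> c p" E by (rule symplectic_tangent_space[OF c(1,3)])
  interpret s': symplectic_space_values "scal B" "\<omega> c' p" E by (rule symplectic_fibre[OF c(2,4)])
  \<comment> \<open>The derivative of the chart change carries \<open>E\<close> and its dual basis
    to a dual pair for \<omega> in the new chart, so \<open>contract_eq\<close> identifies the two
    contractions.\<close>
  have "(\<Sum>b\<in>E. Re (\<omega> c' p [v, ?T (s.dual b)]) *\<^sub>R ?T b) = v" for v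
  proof -
    obtain u where v: "v = ?T u" using transition_deriv_surj[OF c] by (metis surjD)
    have "(\<Sum>b\<in>E. Re (\<omega> c' p [v, ?T (s.dual b)]) *\<^sub>R ?T b) = ?T (\<Sum>b\<in>E. Re (\<omega> c p [u, s.dual b]) *\<^sub>R b)"
      using complex_form_transition[OF \<omega>_form c, of "[u, _]"] transition_deriv_linear[OF c]
      by (simp add: v linear_sum linear_scale)
    then show ?thesis by (simp add: s.sum_dual_left v)
  qed
  then have "contract E s'.dual (\<alpha> c' p) (map ?T vs) = (\<Sum>b\<in>E. \<alpha> c' p (?T b # ?T (s.dual b) # map ?T vs))"
    by (rule s'.contract_eq[OF form_alternating[OF \<alpha> c(2,4)], symmetric])
  also have "\<dots> = contract E s.dual (\<alpha> c p) vs"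
    unfolding contract_def using form_transition[OF \<alpha> c, of "_ # _ # vs"] by simp
  finally show "contraction \<alpha> c' p (map ?T vs) = contraction \<alpha> c p vs"
    using c by (simp add: contraction_def)
next
  fix c V s vs assume c: "c \<in> A" and V: "(V, s) \<in> frames B"
  let ?r = "\<lambda>p b l. real_vector.representation E (dual_vector E (\<omega> c p) b) l"
  \<comment> \<open>Smoothness of \<alpha> is given for constant arguments only, while the dual
    vectors vary with \<open>p\<close>; hence they are expanded in \<open>E\<close> with smooth
    coordinates.\<close>
  have "smooth_multiple B c V s (\<lambda>p. \<Sum>b\<in>E. \<Sum>l\<in>E. scal B (of_real (?r p b l)) (\<alpha> c p (b # l # vs)))"
  proof (intro smooth_multiple_sum[OF c V])
    fix b l assume "b \<in> E" "l \<in> E"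
    then obtain g where "smooth_on (snd c ` fst c) g" "\<And>p. p \<in> fst c \<Longrightarrow> complex_of_real (?r p b l) = g (snd c p)"
      using dual_coordinate_smooth[OF c] by blast
    then show "smooth_multiple B c V s (\<lambda>p. scal B (of_real (?r p b l)) (\<alpha> c p (b # l # vs)))"
      by (intro smooth_multiple_scale[OF c V form_smooth[OF \<alpha> c V]])
  qed
  then show "smooth_multiple B c V s (\<lambda>p. contraction \<alpha> c p vs)"
  proof (rule smooth_multiple_cong)
    fix p assume p: "p \<in> fst c"
    have "\<alpha> c p (b # dual_vector E (\<omega> c p) b # vs) = (\<Sum>l\<in>E. scal B (of_real (?r p b l)) (\<alpha> c p (b # l # vs)))" for b
      using alternating_sum_scaleR[OF form_alternating[OF \<alpha> c p], of "[b]" "?r p b" "\<lambda>l. l" E vs]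
        real_vector.sum_representation_eq[OF basis(2) _ basis(1) order.refl, of "dual_vector E (\<omega> c p) b"] basis(3) by simp
    then show "contraction \<alpha> c p vs = (\<Sum>b\<in>E. \<Sum>l\<in>E. scal B (of_real (?r p b l)) (\<alpha> c p (b # l # vs)))"
      using c p by (simp add: contraction_def contract_def)
  qed
qed (auto simp: contraction_def)

lemma contraction_low_degree:
  assumes \<alpha>: "\<alpha> \<in> bundle_forms A B k" and "k < 2"
  shows "contraction \<alpha> = 0"
proof -
  have "\<alpha> c p (v # w # vs) = 0" if "c \<in> A" "p \<in> fst c" for c p v w vs
    using assms(2) by (intro alternating_length[OF form_alternating[OF \<alpha> that]]) simp
  then show ?thesis by (simp add: contraction_def contract_def fun_eq_iff)
qed

lemma contraction_scale: "contraction (form_scale B z \<alpha>) = form_scale B z (contraction \<alpha>)"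
  by (intro ext) (auto simp: contraction_def contract_def form_scale_def scale_sum_right)

section \<open>The Lefschetz operator: injectivity below and surjectivity above the middle
  degree\<close>

abbreviation lefschetz :: "('a, 'e, 'v) form \<Rightarrow> ('a, 'e, 'v) form" where
  "lefschetz \<equiv> wedge B 2 \<omega>"

lemma lefschetz_form: "\<alpha> \<in> bundle_forms A B k \<Longrightarrow> lefschetz \<alpha> \<in> bundle_forms A B (k + 2)"
  using wedge_form[OF \<omega>_form, of \<alpha> k] by (simp add: add.commute)

lemma lefschetz_add: "lefschetz (\<alpha> + \<beta>) = lefschetz \<alpha> + lefschetz \<beta>"
  by (simp add: wedge_def fun_eq_iff scale_right_distrib sum.distrib)

lemma lefschetz_scale: "lefschetz (form_scale B z \<alpha>) = form_scale B z (lefschetz \<alpha>)"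
  by (simp add: wedge_def form_scale_def fun_eq_iff scale_sum_right mult.commute)

lemma contraction_lefschetz:
  assumes \<alpha>: "\<alpha> \<in> bundle_forms A B k"
  shows "contraction (lefschetz \<alpha>) = lefschetz (contraction \<alpha>) + form_scale B (2 * (of_nat m - of_nat k)) \<alpha>"
proof (intro ext)
  fix c p vs
  show "contraction (lefschetz \<alpha>) c p vs =
      (lefschetz (contraction \<alpha>) + form_scale B (2 * (of_nat m - of_nat k)) \<alpha>) c p vs"
  proof (cases "c \<in> A \<and> p \<in> fst c")
    case True
    then interpret s: symplectic_space_values "scal B" "\<omega> c p" E by (intro symplectic_fibre) auto
    show ?thesis
      using True s.contract_shuffle_wedge[OF form_alternating[OF \<alpha>], of c p vs]
      by (simp add: contraction_def wedge_eq_shuffle_wedge form_scale_def card_basis right_diff_distrib cong: if_cong)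
  next
    case False
    then show ?thesis by (auto simp: contraction_def wedge_def form_scale_def form_outside[OF \<alpha>])
  qed
qed

lemma form_eq_0:
  assumes \<alpha>: "\<alpha> \<in> bundle_forms A B k" and "2 * m < k"
  shows "\<alpha> = 0"
proof (intro ext)
  fix c p vs
  show "\<alpha> c p vs = 0 c p vs"
    using form_outside[OF \<alpha>, of c p vs] alternating_eq_0[OF form_alternating[OF \<alpha>] basis(1,3), of c p vs] assms(2)
    by (cases "c \<in> A \<and> p \<in> fst c") (auto simp: card_basis)
qed

text \<open>
  With \<open>C\<close> the contraction, \<open>L C \<alpha> = - t \<alpha>\<close> implies \<open>L C \<beta> = - t' \<beta>\<close> for \<open>\<beta> = C \<alpha>\<close> and some \<open>t' \<ge> t\<close>, so
  the degree can be lowered until \<open>C \<alpha> = 0\<close>.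
\<close>

lemma lefschetz_contraction_eigenform:
  assumes "\<alpha> \<in> bundle_forms A B k" "k \<le> m" "0 < t"
    and "lefschetz (contraction \<alpha>) = form_scale B (- of_real t) \<alpha>"
  shows "\<alpha> = 0"
  using assms
proof (induction k arbitrary: \<alpha> t rule: less_induct)
  case (less k)
  let ?\<beta> = "contraction \<alpha>"
  have "?\<beta> = 0"
  proof (cases "k < 2")
    case True
    then show ?thesis by (rule contraction_low_degree[OF less.prems(1)])
  next
    case False
    \<comment> \<open>Contracting the hypothesis gives the value of C L on \<open>?\<beta>\<close>;
      the commutator in degree \<open>k - 2\<close> then shifts \<open>t\<close> by 2 (m - (k - 2)),
      which is nonnegative below the middle degree.\<close>
    let ?s = "t + 2 * (real m - real (k - 2))"
    have \<beta>: "?\<beta> \<in> bundle_forms A B (k - 2)" by (rule contraction_form[OF less.prems(1)])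
    have "contraction (lefschetz ?\<beta>) = form_scale B (- of_real t) ?\<beta>"
      unfolding less.prems(4) contraction_scale ..
    then have "lefschetz (contraction ?\<beta>) =
        form_scale B (- of_real t) ?\<beta> - form_scale B (2 * (of_nat m - of_nat (k - 2))) ?\<beta>"
      unfolding contraction_lefschetz[OF \<beta>] by (simp add: algebra_simps)
    also have "\<dots> = form_scale B (- of_real ?s) ?\<beta>"
      by (simp only: forms.scale_left_diff_distrib[symmetric]) simp
    finally have eq: "lefschetz (contraction ?\<beta>) = form_scale B (- of_real ?s) ?\<beta>" .
    have "real (k - 2) \<le> real m" using less.prems(2) by simp
    then have "0 < ?s" using less.prems(3) by simp
    then show ?thesis
      by (intro less.IH[OF _ \<beta> _ _ eq]) (use False less.prems(2) in auto)
  qed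
  then have "form_scale B (- of_real t) \<alpha> = 0"
    using less.prems(4) by (simp add: wedge_def fun_eq_iff)
  then show ?case using less.prems(3) by simp
qed

text \<open>If L \<alpha> = 0, the commutator relation makes \<alpha> an eigenform of L C with
  eigenvalue - 2 (m - k), which is negative.\<close>

lemma lefschetz_injective:
  assumes \<alpha>: "\<alpha> \<in> bundle_forms A B k" "k < m" "lefschetz \<alpha> = 0"
  shows "\<alpha> = 0"
proof (rule lefschetz_contraction_eigenform[OF \<alpha>(1), of "2 * (real m - real k)"])
  have "contraction (lefschetz \<alpha>) = 0"
    unfolding \<alpha>(3) by (simp add: contraction_def contract_def fun_eq_iff)
  then have "lefschetz (contraction \<alpha>) = - form_scale B (2 * (of_nat m - of_nat k)) \<alpha>"
    unfolding contraction_lefschetz[OF \<alpha>(1)] by (rule eq_neg_iff_add_eq_0[THEN iffD2])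
  then show "lefschetz (contraction \<alpha>) = form_scale B (- of_real (2 * (real m - real k))) \<alpha>"
    by (simp add: forms.scale_minus_left[symmetric] del: forms.scale_minus_left)
qed (use \<alpha>(2) in auto)

text \<open>
  If \<open>\<beta>\<close> solves \<open>C L \<beta> + t \<beta> = \<alpha>\<close>, then \<open>\<gamma> = L \<beta>\<close> solves the same type of equation
  \<open>C L \<gamma> + (t + 2 (k + 2 - m)) \<gamma> = L \<alpha>\<close> two degrees higher; conversely \<open>\<beta>\<close> is recovered as
  \<open>(\<alpha> - C \<gamma>) / t\<close>. Working with \<open>C\<close> rather than with fibrewise inverses of \<open>L\<close> keeps the solution
  smooth.
\<close>

lemma contraction_lefschetz_shift_surjective:
  assumes "\<alpha> \<in> bundle_forms A B k" "m \<le> k" "0 < t"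
  shows "\<exists>\<beta>\<in>bundle_forms A B k. contraction (lefschetz \<beta>) + form_scale B (of_real t) \<beta> = \<alpha>"
  using assms
proof (induction "2 * m + 1 - k" arbitrary: k \<alpha> t rule: less_induct)
  case less
  show ?case
  proof (cases "2 * m < k")
    case True
    \<comment> \<open>The upward recursion ends above the top degree, where every form is
      zero.\<close>
    have "contraction (lefschetz 0) + form_scale B (of_real t) 0 = 0"
      by (simp add: contraction_def contract_def wedge_def fun_eq_iff form_scale_def)
    then show ?thesis using form_eq_0[OF less.prems(1) True] zero_form by blast
  next
    case False
    let ?s = "t + 2 * (real (k + 2) - real m)"
    have "0 < ?s" using less.prems(2,3) by simp
    then obtain \<gamma> where \<gamma>: "\<gamma> \<in> bundle_forms A B (k + 2)"
      and eq: "contraction (lefschetz \<gamma>) + form_scale B (of_real ?s) \<gamma> = lefschetz \<alpha>"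
      using less.hyps[OF _ lefschetz_form[OF less.prems(1)]] False less.prems(2) by fastforce
    define \<beta> where "\<beta> = form_scale B (1 / of_real t) (\<alpha> + form_scale B (- 1) (contraction \<gamma>))"
    \<comment> \<open>L \<alpha> - L C \<gamma> equals the commutator of C and L on \<gamma> plus
      \<open>?s\<close> times \<gamma>; the choice of \<open>?s\<close> leaves t \<gamma>, so that L
      \<beta> = \<gamma>.\<close>
    have "lefschetz \<alpha> + form_scale B (- 1) (lefschetz (contraction \<gamma>)) =
        form_scale B (2 * (of_nat m - of_nat (k + 2))) \<gamma> + form_scale B (of_real ?s) \<gamma>"
      unfolding eq[symmetric] contraction_lefschetz[OF \<gamma>] by (simp add: algebra_simps)
    also have "\<dots> = form_scale B (of_real t) \<gamma>"
      by (simp only: forms.scale_left_distrib[symmetric]) simp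
    finally have "lefschetz \<beta> = \<gamma>"
      unfolding \<beta>_def lefschetz_scale lefschetz_add using less.prems(3) by simp
    then have "contraction (lefschetz \<beta>) + form_scale B (of_real t) \<beta> = \<alpha>"
      unfolding \<beta>_def using less.prems(3) by simp
    moreover have "\<beta> \<in> bundle_forms A B k"
      unfolding \<beta>_def using contraction_form[OF \<gamma>] less.prems(1)
      by (intro add_form scale_form) simp_all
    ultimately show ?thesis by blast
  qed
qed

text \<open>For the shift t = 2 (k - m) the commutator relation turns C L + t into L C, so the
  solution \<gamma> of the shifted equation gives the preimage C \<gamma>.\<close>

lemma lefschetz_surjective:
  assumes \<alpha>: "\<alpha> \<in> bundle_forms A B k" "m < k"
  obtains \<beta> where "\<beta> \<in> bundle_forms A B (k - 2)" "lefschetz \<beta> = \<alpha>"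
proof -
  obtain \<gamma> where \<gamma>: "\<gamma> \<in> bundle_forms A B k"
    and eq: "contraction (lefschetz \<gamma>) + form_scale B (of_real (2 * (real k - real m))) \<gamma> = \<alpha>"
    using contraction_lefschetz_shift_surjective[OF \<alpha>(1), of "2 * (real k - real m)"] \<alpha>(2) by auto
  have "form_scale B (2 * (of_nat m - of_nat k)) \<gamma> + form_scale B (of_real (2 * (real k - real m))) \<gamma> = 0"
    by (simp only: forms.scale_left_distrib[symmetric]) simp
  then have "lefschetz (contraction \<gamma>) = \<alpha>"
    using eq unfolding contraction_lefschetz[OF \<gamma>] by (simp add: add.assoc)
  then show ?thesis using that contraction_form[OF \<gamma>] by blast
qed

end

section \<open>Cohomology\<close>

theorem theorem2:
  fixes M :: "'a topology"
    and A :: "('a, 'e::real_normed_vector) chart set"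
    and \<omega> :: "('a, 'e, complex) form"
    and B :: "('a, 'v::ab_group_add) line_bundle"
    and h :: "'a \<Rightarrow> 'v \<Rightarrow> 'v \<Rightarrow> complex"
    and nabla D :: "('a, 'e, 'v) form \<Rightarrow> ('a, 'e, 'v) form"
    and m k :: nat
  assumes "prequantum_system m M A \<omega> B h nabla D"
    and "k \<noteq> m"
  shows "D_cohomology A B \<omega> D k = {cohomology_class (Gamma_forms A B \<omega>) D k 0}"
proof -
  let ?\<Gamma> = "Gamma_forms A B \<omega>"
  have manifold: "smooth_manifold (2 * m) M A" and symplectic: "symplectic_form M A \<omega>"
    and line_bundle: "smooth_line_bundle M A B" and ind: "induced_operator M A B nabla D"
    and curvature: "\<forall>j. \<forall>\<alpha>\<in>bundle_forms A B j. D (D \<alpha>) = form_scale B (- \<i>) (wedge B 2 \<omega> \<alpha>)"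
    using assms(1) unfolding prequantum_system_def by - (elim conjE, assumption)+
  have D_form: "\<forall>j. \<forall>\<alpha>\<in>bundle_forms A B j. D \<alpha> \<in> bundle_forms A B (Suc j)"
    and D_add: "\<forall>j. \<forall>\<alpha>\<in>bundle_forms A B j. \<forall>\<beta>\<in>bundle_forms A B j. D (\<alpha> + \<beta>) = D \<alpha> + D \<beta>"
    using ind unfolding induced_operator_def by - (elim conjE, assumption)+
  note curvature = curvature[rule_format] and D_form = D_form[rule_format] and D_add = D_add[rule_format]
  obtain E :: "'e set" where "finite E" "independent E" "span E = UNIV" "card E = 2 * m"
    using manifold unfolding smooth_manifold_def by (elim conjE exE) blast
  then interpret symplectic_line_bundle m M A \<omega> B E
    by unfold_locales (use manifold symplectic line_bundle in auto)
  have D_0: "D 0 = 0" using D_add[OF zero_form zero_form] by simp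
  have \<Gamma>_0: "0 \<in> ?\<Gamma> j" for j
    using zero_form by (simp add: Gamma_forms_def wedge_def fun_eq_iff)
  \<comment> \<open>Only additivity of \<open>D\<close> is given, so its value on a difference is
    obtained by adding \<beta> back inside the complex.\<close>
  have \<Gamma>_diff: "\<alpha> - \<beta> \<in> ?\<Gamma> j" "D (\<alpha> - \<beta>) = D \<alpha> - D \<beta>" if "\<alpha> \<in> ?\<Gamma> j" "\<beta> \<in> ?\<Gamma> j" for \<alpha> \<beta> j
  proof -
    have d: "\<alpha> - \<beta> = \<alpha> + form_scale B (- 1) \<beta>" by simp
    have \<beta>: "form_scale B (- 1) \<beta> \<in> bundle_forms A B j" using that by (simp only: Gamma_forms_def mem_Collect_eq scale_form)
    show "\<alpha> - \<beta> \<in> ?\<Gamma> j"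
      using that \<beta> unfolding d Gamma_forms_def mem_Collect_eq lefschetz_add lefschetz_scale
      by (simp only: add_form) simp
    then have "D (\<alpha> - \<beta> + \<beta>) = D (\<alpha> - \<beta>) + D \<beta>"
      using that by (intro D_add[of _ j]) (simp_all only: Gamma_forms_def mem_Collect_eq)
    then show "D (\<alpha> - \<beta>) = D \<alpha> - D \<beta>" by simp
  qed
  have boundary: "z \<in> coboundaries ?\<Gamma> D k" if z: "z \<in> cocycles ?\<Gamma> D k" for z
  proof -
    have z_form: "z \<in> bundle_forms A B k" and Lz: "lefschetz z = 0" and Dz: "D z = 0"
      using z by (simp_all add: cocycles_def Gamma_forms_def)
    show ?thesis
    proof (cases "k < m")
      case True
      then have "z = 0" using lefschetz_injective z_form Lz by blast
      then show ?thesis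
        unfolding coboundaries_def using \<Gamma>_0 D_0 by (force split: nat.split)
    next
      case False
      then have k: "m < k" using assms(2) by simp
      obtain \<gamma> where \<gamma>: "\<gamma> \<in> bundle_forms A B (k - 2)" "lefschetz \<gamma> = z"
        by (rule lefschetz_surjective[OF z_form k])
      show ?thesis
      proof (cases "2 \<le> k")
        case True
        \<comment> \<open>The factor \<i> cancels the - \<i> of the curvature: D (D (\<i> \<gamma>))
          = L \<gamma> = z.\<close>
        define \<beta> where "\<beta> = D (form_scale B \<i> \<gamma>)"
        have \<beta>: "\<beta> \<in> bundle_forms A B (k - 1)"
        proof -
          have "Suc (k - 2) = k - 1" using True by simp
          then show ?thesis using D_form[OF scale_form[OF \<gamma>(1), of \<i>]] by (simp only: \<beta>_def)
        qed
        have D\<beta>: "D \<beta> = z"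
          unfolding \<beta>_def curvature[OF scale_form[OF \<gamma>(1)]] lefschetz_scale \<gamma>(2) by simp
        \<comment> \<open>The curvature identity a second time, now for \<beta>: because
          \<open>z\<close> is a cocycle, \<beta> lies in the kernel of L.\<close>
        have "form_scale B (- \<i>) (lefschetz \<beta>) = 0"
          using curvature[OF \<beta>] Dz by (simp add: D\<beta>)
        then have "\<beta> \<in> ?\<Gamma> (k - 1)" using \<beta> by (simp add: Gamma_forms_def)
        then show ?thesis
          unfolding coboundaries_def using D\<beta> True by (cases k) auto
      next
        case False
        \<comment> \<open>Here \<open>k = 1\<close> and \<open>m = 0\<close>: the degree
          \<open>k - 2\<close> is truncated, but there are no nonzero forms above the top
          degree.\<close>
        then have "2 * m < k" using k by simp
        then have "z = 0" using form_eq_0[OF z_form] by blast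
        then show ?thesis
          unfolding coboundaries_def using \<Gamma>_0 D_0 by (force split: nat.split)
      qed
    qed
  qed
  \<comment> \<open>Coboundaries form a group containing every cocycle, so all cohomology classes
    are the same coset.\<close>
  have "(+) z ` coboundaries ?\<Gamma> D k = coboundaries ?\<Gamma> D k" if z: "z \<in> cocycles ?\<Gamma> D k" for z
  proof -
    have diff: "x - y \<in> coboundaries ?\<Gamma> D k"
      if "x \<in> coboundaries ?\<Gamma> D k" "y \<in> coboundaries ?\<Gamma> D k" for x y
      using that \<Gamma>_diff unfolding coboundaries_def by (auto split: nat.splits) (metis image_eqI)
    have 0: "0 \<in> coboundaries ?\<Gamma> D k"
      using \<Gamma>_0 D_0 unfolding coboundaries_def by (force split: nat.split)
    have "z + y \<in> coboundaries ?\<Gamma> D k" if "y \<in> coboundaries ?\<Gamma> D k" for y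
      using diff[OF boundary[OF z] diff[OF 0 that]] by simp
    moreover have "y = z + (y - z)" for y by simp
    ultimately show ?thesis using diff boundary[OF z] by blast
  qed
  moreover have "0 \<in> cocycles ?\<Gamma> D k" using \<Gamma>_0 D_0 by (simp add: cocycles_def)
  ultimately show ?thesis
    unfolding D_cohomology_def cohomology_def cohomology_class_def by (auto simp: image_iff)
qed

end
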